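(* Let $\delta_1<\delta_2$ be real, let $\mathcal Y_m$ be a set of $m$ distinct points in $(\delta_1,\delta_2)$, let $c\in(0,1)$, and let $D_{[i]}(\tau,c)$ be the subdigraph, on the points in $\mathcal I_i$, of the central similarity proximity catch digraph based on uniform data in $(\delta_1,\delta_2)$, with relative density $\rho_{[i]}(\tau,c)$. Then for $i\in\{1,m+1\}$ (i.e., in the end intervals) and $\tau\in(0,\infty)$, as $n_i\to\infty$, $$\sqrt{n_i}\,[\rho_{[i]}(\tau,c)-\mu_e(\tau)]\to\mathcal N(0,4\,\nu_e(\tau))\quad\text{in law},$$ where $$\mu_e(\tau)=\begin{cases}\dfrac{\tau(\tau+2)}{2(\tau+1)} & 0<\tau<1,\\[2mm] \dfrac{1+2\tau}{2(\tau+1)} & \tau\ge1,\end{cases}\qquad 4\,\nu_e(\tau)=\begin{cases}\dfrac{\tau^2(4\tau+4-2\tau^4-4\tau^3-\tau^2)}{3(\tau+1)^3} & 0<\tau<1,\\[2mm] \dfrac{\tau^2}{3(\tau+1)^3} & \tau\ge1.\end{cases}$$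
   Context: $\mathcal N(\mu,\sigma^2)$ is the normal distribution with mean $\mu$ and variance $\sigma^2$. $y_{(1)}<\dots<y_{(m)}$ are the ordered points of $\mathcal Y_m$ ($m\ge1$), and the end intervals are $\mathcal I_1=(\delta_1,y_{(1)})$ and $\mathcal I_{m+1}=(y_{(m)},\delta_2)$. $\mathcal X_n$ is an iid sample from the uniform distribution on $(\delta_1,\delta_2)$, $\mathcal X_{[i]}:=\mathcal X_n\cap\mathcal I_i$, $n_i:=|\mathcal X_{[i]}|$. Given $n_i$, the points of $\mathcal X_{[i]}$ are $n_i$ iid uniform points on $\mathcal I_i$, and the limit as $n_i\to\infty$ is for $\rho_{[i]}$ built on $n_i$ such points. The proximity region with expansion parameter $\tau>0$ is $N_e(x,\tau)=(x-\tau(y_{(1)}-x),\,x+\tau(y_{(1)}-x))\cap\mathcal I_1$ for $x\in\mathcal I_1$ and $N_e(x,\tau)=(x-\tau(x-y_{(m)}),\,x+\tau(x-y_{(m)}))\cap\mathcal I_{m+1}$ for $x\in\mathcal I_{m+1}$ (the parameter $c$ plays no role in end intervals). $D_{[i]}(\tau,c)$ has vertex set $\mathcal X_{[i]}$ and an arc $(X_j,X_k)$, for distinct vertices, iff $X_k\in N_e(X_j,\tau)$. $\rho_{[i]}(\tau,c)$ is its number of arcs divided by $n_i(n_i-1)$. *)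

theory Defs
  imports "HOL-Probability.Probability" "Graph_Theory.Pair_Digraph"
begin

text \<open>Order statistics of the finite set \<open>Y\<close>, extended by the two end points of the support:
  index \<open>0\<close> gives \<open>\<delta>1\<close>, index \<open>j \<in> {1..m}\<close> the \<open>j\<close>-th smallest point of \<open>Y\<close>, and index
  \<open>m + 1\<close> gives \<open>\<delta>2\<close>, where \<open>m = card Y\<close>.\<close>

definition ypt :: "real \<Rightarrow> real \<Rightarrow> real set \<Rightarrow> nat \<Rightarrow> real" where
  "ypt \<delta>1 \<delta>2 Y j =
     (if j = 0 then \<delta>1 else if j \<le> card Y then sorted_list_of_set Y ! (j - 1) else \<delta>2)"

definition y_interval :: "real \<Rightarrow> real \<Rightarrow> real set \<Rightarrow> nat \<Rightarrow> real set" where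
  "y_interval \<delta>1 \<delta>2 Y i = {ypt \<delta>1 \<delta>2 Y (i - 1) <..< ypt \<delta>1 \<delta>2 Y i}"

text \<open>The proximity region is specified on the two end intervals only; it is left
  \<open>undefined\<close> for all other points.\<close>

definition N_end :: "real \<Rightarrow> real \<Rightarrow> real set \<Rightarrow> real \<Rightarrow> real \<Rightarrow> real set" where
  "N_end \<delta>1 \<delta>2 Y \<tau> x =
     (let m = card Y; a = ypt \<delta>1 \<delta>2 Y 1; b = ypt \<delta>1 \<delta>2 Y m in
      if x \<in> y_interval \<delta>1 \<delta>2 Y 1
        then {x - \<tau> * (a - x) <..< x + \<tau> * (a - x)} \<inter> y_interval \<delta>1 \<delta>2 Y 1
      else if x \<in> y_interval \<delta>1 \<delta>2 Y (m + 1)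
        then {x - \<tau> * (x - b) <..< x + \<tau> * (x - b)} \<inter> y_interval \<delta>1 \<delta>2 Y (m + 1)
      else undefined)"

definition sample :: "(nat \<Rightarrow> 'a \<Rightarrow> real) \<Rightarrow> nat \<Rightarrow> 'a \<Rightarrow> real set" where
  "sample X n \<omega> = (\<lambda>j. X j \<omega>) ` {..<n}"

text \<open>The subdigraph on the points of the data set \<open>S\<close> in the \<open>i\<close>-th interval, for an end
  interval \<open>i\<close>. The centrality parameter \<open>c\<close> is kept as an argument, but it does not
  influence the proximity regions in the end intervals.\<close>

definition cs_digraph ::
  "real \<Rightarrow> real \<Rightarrow> real set \<Rightarrow> real set \<Rightarrow> nat \<Rightarrow> real \<Rightarrow> real \<Rightarrow> real pair_pre_digraph" where
  "cs_digraph \<delta>1 \<delta>2 Y S i \<tau> c =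
     (let V = S \<inter> y_interval \<delta>1 \<delta>2 Y i in
      \<lparr> pverts = V,
        parcs = {(u, v). u \<in> V \<and> v \<in> V \<and> u \<noteq> v \<and> v \<in> N_end \<delta>1 \<delta>2 Y \<tau> u} \<rparr>)"

definition relative_density :: "'v pair_pre_digraph \<Rightarrow> real" where
  "relative_density D =
     real (card (parcs D)) / (real (card (pverts D)) * (real (card (pverts D)) - 1))"

definition mu_e :: "real \<Rightarrow> real" where
  "mu_e \<tau> = (if \<tau> < 1 then \<tau> * (\<tau> + 2) / (2 * (\<tau> + 1)) else (1 + 2 * \<tau>) / (2 * (\<tau> + 1)))"

definition nu_e :: "real \<Rightarrow> real" where
  "nu_e \<tau> =
     (if \<tau> < 1
      then \<tau>^2 * (4 * \<tau> + 4 - 2 * \<tau>^4 - 4 * \<tau>^3 - \<tau>^2) / (3 * (\<tau> + 1)^3)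
      else \<tau>^2 / (3 * (\<tau> + 1)^3)) / 4"

text \<open>The normal distribution with given mean and \<^emph>\<open>variance\<close>; the second argument of
  \<open>normal_density\<close> is the standard deviation.\<close>

definition normal_dist :: "real \<Rightarrow> real \<Rightarrow> real measure" where
  "normal_dist \<mu> v = density lborel (\<lambda>x. ennreal (normal_density \<mu> (sqrt v) x))"

end

theory Submission
  imports Defs "HOL-Real_Asymp.Real_Asymp"
begin

text \<open>Given \<open>n\<^sub>i = k\<close>, the set of indices of the observations that hit the end interval is a
  random \<open>k\<close>-subset, and given that set these observations are \<open>k\<close> independent uniform points on
  the interval. Summing over the subsets, the conditional law of the relative density is that of
  a U-statistic of order two, with kernel \<open>1[y \<in> N(x)]\<close>, of \<open>k\<close> such points.

  A U-statistic is the sum of its Hajek projection and a degenerate part. The terms of the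
  degenerate part are orthogonal unless they involve the same pair of points, so its contribution
  at scale \<open>sqrt k\<close> vanishes in \<open>L\<^sup>1\<close>; the projection is a normalised sum of iid variables, to which
  the central limit theorem applies. An affine change of variables, which maps the point of \<open>Y\<close>
  bounding the interval to \<open>0\<close> and the other end to \<open>1\<close>, reduces mean and variance of the projection
  to integrals of piecewise polynomials that are the same for both end intervals.\<close>

section \<open>Central limit theorem for U-statistics with a bounded kernel\<close>

text \<open>The arc relation is not symmetric, so the kernel has two different projections, and
  their centred sum drives the limit. That sum is twice the projection of the symmetrised kernel;
  hence \<open>nu_e\<close> is the variance of the latter and the limit variance is 2 squared times
  it. The degenerate part has about n squared terms. Orthogonality keeps its second moment at order
  n^2 instead of n^4, and the squared scaling n / (n (n - 1))^2 turns this into order 1/n. The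
  digraph lives on a set of points, whereas conditioning is done on indices. The two counts differ
  only where observations coincide, a null event, so all comparisons between them are almost sure
  ones. For each k the conditional law is exactly, not just asymptotically, that of the U-statistic
  of k points. This is why the total sample size may vary with k in any way that leaves the
  conditioning event a positive probability.\<close>

definition offdiag :: "nat \<Rightarrow> (nat \<times> nat) set" where
  "offdiag n = {(i, j). i < n \<and> j < n \<and> i \<noteq> j}"

lemma offdiag_eq: "offdiag n = {..<n} \<times> {..<n} - (\<lambda>i. (i, i)) ` {..<n}"
  by (auto simp: offdiag_def)

lemma finite_offdiag [simp]: "finite (offdiag n)"
  by (simp add: offdiag_eq)

lemma card_offdiag: "card (offdiag n) = n * (n - 1)"
proof -
  have "card (offdiag n) = n * n - n"
    unfolding offdiag_eq
    by (subst card_Diff_subset) (auto simp: card_cartesian_product card_image inj_on_def)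
  then show ?thesis by (simp add: diff_mult_distrib2)
qed

lemma sum_offdiag_fst: "(\<Sum>(i, j)\<in>offdiag n. f i) = real (n - 1) * (\<Sum>i<n. f i)"
  for f :: "nat \<Rightarrow> real"
proof -
  have "(\<Sum>(i, j)\<in>offdiag n. f i) = (\<Sum>(i, j)\<in>(SIGMA i:{..<n}. {..<n} - {i}). f i)"
    by (rule sum.cong) (auto simp: offdiag_def)
  also have "\<dots> = (\<Sum>i<n. \<Sum>j\<in>{..<n} - {i}. f i)"
    by (subst sum.Sigma) auto
  finally show ?thesis by (simp add: sum_distrib_left)
qed

lemma sum_offdiag_swap: "(\<Sum>(i, j)\<in>offdiag n. f j i) = (\<Sum>(i, j)\<in>offdiag n. f i j)"
  by (rule sum.reindex_bij_witness[where i = prod.swap and j = prod.swap])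
    (auto simp: offdiag_def)

lemma sum_offdiag_snd: "(\<Sum>(i, j)\<in>offdiag n. f j) = real (n - 1) * (\<Sum>i<n. f i)"
  for f :: "nat \<Rightarrow> real"
  using sum_offdiag_swap[of "\<lambda>i j. f i" n] sum_offdiag_fst[of f n] by simp

text \<open>Fubini with coordinate \<open>i\<close> innermost. It will kill products in which some
  coordinate enters through a single degenerate factor.\<close>

lemma integral_PiM_eq_0:
  fixes f :: "('i \<Rightarrow> 'b) \<Rightarrow> real"
  assumes "prob_space V" "finite I" "i \<in> I" "integrable (PiM I (\<lambda>_. V)) f"
    and z: "\<And>x. x \<in> space (PiM (I - {i}) (\<lambda>_. V)) \<Longrightarrow> (\<integral>y. f (x(i := y)) \<partial>V) = 0"
  shows "integral\<^sup>L (PiM I (\<lambda>_. V)) f = 0"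
proof -
  interpret prob_space V by fact
  interpret product_sigma_finite "\<lambda>_. V" ..
  have "integral\<^sup>L (PiM (insert i (I - {i})) (\<lambda>_. V)) f
      = (\<integral>x. (\<integral>y. f (x(i := y)) \<partial>V) \<partial>PiM (I - {i}) (\<lambda>_. V))"
    using assms by (intro product_integral_insert) (auto simp: insert_absorb)
  also have "\<dots> = (\<integral>x. 0 \<partial>PiM (I - {i}) (\<lambda>_. V))"
    by (rule Bochner_Integration.integral_cong) (auto simp: z)
  finally show ?thesis using \<open>i \<in> I\<close> by (simp add: insert_absorb)
qed

text \<open>The bound is imposed on the whole type, not just on the space of \<open>V\<close>, so
  that projections are bounded at every point and no membership conditions accompany the
  estimates.\<close>

locale bounded_kernel = prob_space V for V :: "'b measure" +
  fixes h :: "'b \<Rightarrow> 'b \<Rightarrow> real" and B :: real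
  assumes h_measurable: "case_prod h \<in> borel_measurable (V \<Otimes>\<^sub>M V)"
    and h_bound: "\<bar>h x y\<bar> \<le> B"
begin

definition proj1 :: "'b \<Rightarrow> real" where "proj1 x = (\<integral>y. h x y \<partial>V)"
definition proj2 :: "'b \<Rightarrow> real" where "proj2 y = (\<integral>x. h x y \<partial>V)"
definition mean :: real where "mean = (\<integral>x. proj1 x \<partial>V)"
text \<open>The second-order term of the Hoeffding decomposition: removing both projections removes
  the mean twice, so it is added back once.\<close>

definition degen :: "'b \<Rightarrow> 'b \<Rightarrow> real" where
  "degen x y = h x y - proj1 x - proj2 y + mean"

definition ustat :: "nat \<Rightarrow> (nat \<Rightarrow> 'b) \<Rightarrow> real" where
  "ustat n x = (\<Sum>(i, j)\<in>offdiag n. h (x i) (x j)) / (real n * (real n - 1))"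

sublocale VV: pair_prob_space V V ..

sublocale P: product_prob_space "\<lambda>_::nat. V" I for I ..

lemma B_nonneg: "0 \<le> B"
  using h_bound[of undefined undefined] by linarith

lemma integral_bounded:
  fixes f :: "'b \<Rightarrow> real"
  assumes "f \<in> borel_measurable V" "\<And>x. \<bar>f x\<bar> \<le> C"
  shows "\<bar>integral\<^sup>L V f\<bar> \<le> C"
proof -
  have "\<bar>integral\<^sup>L V f\<bar> \<le> (\<integral>x. \<bar>f x\<bar> \<partial>V)" by (rule integral_abs_bound)
  also have "\<dots> \<le> (\<integral>x. C \<partial>V)"
    using assms by (intro integral_mono) (auto intro!: integrable_const_bound[where B=C])
  finally show ?thesis by (simp add: prob_space)
qed

lemma h_meas [measurable (raw)]:
  assumes "f \<in> measurable M V" "g \<in> measurable M V"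
  shows "(\<lambda>x. h (f x) (g x)) \<in> borel_measurable M"
  using measurable_compose[OF measurable_Pair[OF assms] h_measurable] by simp

lemma proj1_measurable [measurable]: "proj1 \<in> borel_measurable V"
  unfolding proj1_def[abs_def] by measurable

lemma proj2_measurable [measurable]: "proj2 \<in> borel_measurable V"
  unfolding proj2_def[abs_def] by measurable

lemma h_integrable1: "x \<in> space V \<Longrightarrow> integrable V (h x)"
  using h_bound by (intro integrable_const_bound[where B=B]) auto

lemma h_integrable2: "y \<in> space V \<Longrightarrow> integrable V (\<lambda>x. h x y)"
  using h_bound by (intro integrable_const_bound[where B=B]) auto

lemma proj1_bound: "\<bar>proj1 x\<bar> \<le> B"
proof (cases "h x \<in> borel_measurable V")
  case True then show ?thesis unfolding proj1_def using h_bound by (intro integral_bounded)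
next
  case False
  \<comment> \<open>The Bochner integral of a non-integrable function is 0 by convention, which
    respects the bound.\<close>
  then have "proj1 x = 0" unfolding proj1_def by (intro not_integrable_integral_eq) auto
  then show ?thesis using B_nonneg by simp
qed

lemma proj2_bound: "\<bar>proj2 y\<bar> \<le> B"
proof (cases "(\<lambda>x. h x y) \<in> borel_measurable V")
  case True then show ?thesis unfolding proj2_def using h_bound by (intro integral_bounded)
next
  case False
  then have "proj2 y = 0" unfolding proj2_def by (intro not_integrable_integral_eq) auto
  then show ?thesis using B_nonneg by simp
qed

lemma proj1_integrable: "integrable V proj1"
  using proj1_bound by (intro integrable_const_bound[where B=B]) auto

lemma proj2_integrable: "integrable V proj2"
  using proj2_bound by (intro integrable_const_bound[where B=B]) auto

lemma mean_bound: "\<bar>mean\<bar> \<le> B"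
  unfolding mean_def using proj1_bound by (intro integral_bounded) auto

lemma mean_proj2: "(\<integral>y. proj2 y \<partial>V) = mean"
  unfolding mean_def proj1_def proj2_def
  using h_bound by (intro VV.Fubini_integral VV.P.integrable_const_bound[where B=B])
    (auto simp: h_measurable)

lemma degen_measurable [measurable (raw)]:
  assumes [measurable]: "f \<in> measurable M V" "g \<in> measurable M V"
  shows "(\<lambda>x. degen (f x) (g x)) \<in> borel_measurable M"
  unfolding degen_def by measurable

lemma degen_bound: "\<bar>degen x y\<bar> \<le> 4 * B"
  using h_bound[of x y] proj1_bound[of x] proj2_bound[of y] mean_bound
  unfolding degen_def by linarith

lemma degen_mult_bound: "\<bar>degen x y * degen x' y'\<bar> \<le> 16 * B\<^sup>2"
proof -
  have "\<bar>degen x y * degen x' y'\<bar> \<le> (4 * B) * (4 * B)"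
    unfolding abs_mult using degen_bound B_nonneg by (intro mult_mono) auto
  then show ?thesis by (simp add: power2_eq_square)
qed

lemma integral_degen1:
  assumes "x \<in> space V" shows "(\<integral>y. degen x y \<partial>V) = 0"
  unfolding degen_def using h_integrable1[OF assms] proj2_integrable
  by (simp add: prob_space mean_proj2 flip: proj1_def)

lemma integral_degen2:
  assumes "y \<in> space V" shows "(\<integral>x. degen x y \<partial>V) = 0"
  unfolding degen_def using h_integrable2[OF assms] proj1_integrable
  by (simp add: prob_space flip: proj2_def mean_def)

text \<open>Some index of \<open>p\<close> does not occur in \<open>q\<close>. Integrating over that
  coordinate first leaves a section of \<open>degen\<close>, of mean zero, times a constant.\<close>

lemma degen_orthogonal:
  assumes p: "p \<in> offdiag n" and q: "q \<in> offdiag n" and ne: "q \<noteq> p" "q \<noteq> prod.swap p"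
  shows "(\<integral>x. degen (x (fst p)) (x (snd p)) * degen (x (fst q)) (x (snd q)) \<partial>PiM {..<n} (\<lambda>_. V)) = 0"
proof -
  obtain i j where [simp]: "p = (i, j)" by (cases p)
  obtain k l where [simp]: "q = (k, l)" by (cases q)
  have lt [simp]: "i < n" "j < n" "k < n" "l < n" "i \<noteq> j" "k \<noteq> l"
    using p q by (auto simp: offdiag_def)
  have int: "integrable (PiM {..<n} (\<lambda>_. V)) (\<lambda>x. degen (x i) (x j) * degen (x k) (x l))"
    by (rule P.P.integrable_const_bound[where B="16 * B\<^sup>2"])
      (simp only: real_norm_def degen_mult_bound, simp, measurable)
  have sp: "x a \<in> space V" if "x \<in> space (PiM ({..<n} - {b}) (\<lambda>_. V))" "a < n" "a \<noteq> b" for x a b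
    using that by (auto simp: space_PiM)
  have ne': "\<not> (k = i \<and> l = j)" "\<not> (k = j \<and> l = i)" using ne by auto
  show ?thesis
  proof (cases "i \<noteq> k \<and> i \<noteq> l")
    case True
    moreover have "j \<noteq> i" using lt(5) by (rule not_sym)
    ultimately show ?thesis
      by (intro integral_PiM_eq_0[where i=i]) (auto simp: int prob_space_axioms integral_degen2 sp)
  next
    case False
    \<comment> \<open>If \<open>i\<close> occurs in \<open>q\<close>, then \<open>j\<close> cannot:
      otherwise \<open>q\<close> would be \<open>p\<close> or its swap.\<close>
    with ne' have "j \<noteq> k \<and> j \<noteq> l" using lt by metis
    then show ?thesis using lt
      by (intro integral_PiM_eq_0[where i=j]) (auto simp: int prob_space_axioms integral_degen1 sp)
  qed
qed

text \<open>In the expanded square each pair \<open>p\<close> meets at most two non-orthogonal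
  partners, itself and its swap, each contributing at most 16 B^2.\<close>

lemma degen_sum_second_moment:
  "(\<integral>x. (\<Sum>(i, j)\<in>offdiag n. degen (x i) (x j))\<^sup>2 \<partial>PiM {..<n} (\<lambda>_. V))
     \<le> real (n * (n - 1)) * (32 * B\<^sup>2)"
proof -
  let ?d = "\<lambda>p x. degen (x (fst p)) (x (snd p))"
  let ?P = "PiM {..<n} (\<lambda>_. V)"
  have int: "integrable ?P (\<lambda>x. ?d p x * ?d q x)" if "p \<in> offdiag n" "q \<in> offdiag n" for p q
  proof (rule P.P.integrable_const_bound[where B="16 * B\<^sup>2"])
    have [measurable]: "fst p \<in> {..<n}" "snd p \<in> {..<n}" "fst q \<in> {..<n}" "snd q \<in> {..<n}"
      using that by (auto simp: offdiag_def)
    show "(\<lambda>x. ?d p x * ?d q x) \<in> borel_measurable ?P" by measurable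
  qed (simp only: real_norm_def degen_mult_bound, simp)
  have "(\<integral>x. (\<Sum>(i, j)\<in>offdiag n. degen (x i) (x j))\<^sup>2 \<partial>?P)
      = (\<integral>x. (\<Sum>p\<in>offdiag n. \<Sum>q\<in>offdiag n. ?d p x * ?d q x) \<partial>?P)"
    by (simp add: power2_eq_square sum_product case_prod_beta)
  also have "\<dots> = (\<Sum>p\<in>offdiag n. \<Sum>q\<in>offdiag n. (\<integral>x. ?d p x * ?d q x \<partial>?P))"
    by (simp add: int)
  also have "\<dots> \<le> (\<Sum>p\<in>offdiag n. 32 * B\<^sup>2)"
  proof (rule sum_mono)
    fix p assume p: "p \<in> offdiag n"
    have "(\<Sum>q\<in>offdiag n. (\<integral>x. ?d p x * ?d q x \<partial>?P))
        \<le> (\<Sum>q\<in>offdiag n. if q \<in> {p, prod.swap p} then 16 * B\<^sup>2 else 0)"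
    proof (rule sum_mono)
      fix q assume q: "q \<in> offdiag n"
      have "(\<integral>x. ?d p x * ?d q x \<partial>?P) \<le> (\<integral>x. 16 * B\<^sup>2 \<partial>?P)"
        using degen_mult_bound int[OF p q] by (intro integral_mono) (auto simp: abs_le_iff)
      then show "(\<integral>x. ?d p x * ?d q x \<partial>?P) \<le> (if q \<in> {p, prod.swap p} then 16 * B\<^sup>2 else 0)"
        using degen_orthogonal[OF p q] by (auto simp: P.P.prob_space)
    qed
    also have "\<dots> = (\<Sum>q\<in>offdiag n \<inter> {p, prod.swap p}. 16 * B\<^sup>2)"
      by (rule sum.inter_restrict[symmetric]) simp
    also have "\<dots> \<le> (\<Sum>q\<in>{p, prod.swap p}. 16 * B\<^sup>2)"
      by (rule sum_mono2) auto
    also have "\<dots> \<le> 2 * (16 * B\<^sup>2)"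
      by (cases "p = prod.swap p") auto
    finally show "(\<Sum>q\<in>offdiag n. (\<integral>x. ?d p x * ?d q x \<partial>?P)) \<le> 32 * B\<^sup>2" by simp
  qed
  also have "\<dots> = real (n * (n - 1)) * (32 * B\<^sup>2)" by (simp add: card_offdiag)
  finally show ?thesis .
qed

text \<open>Every index is the first, and also the second, component of n - 1 pairs; this factor
  cancels the n - 1 of the normaliser, which is nonzero only from n = 2 on.\<close>

lemma ustat_decomp:
  assumes "2 \<le> n"
  shows "sqrt (real n) * (ustat n x - mean)
     = (\<Sum>i<n. proj1 (x i) + proj2 (x i) - 2 * mean) / sqrt (real n)
       + sqrt (real n) * (\<Sum>(i, j)\<in>offdiag n. degen (x i) (x j)) / (real n * (real n - 1))"
proof -
  let ?N = "real n * (real n - 1)"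
  have N: "?N \<noteq> 0" using assms by auto
  have "(\<Sum>(i, j)\<in>offdiag n. h (x i) (x j))
      = (\<Sum>(i, j)\<in>offdiag n. degen (x i) (x j)) + (\<Sum>(i, j)\<in>offdiag n. proj1 (x i))
        + (\<Sum>(i, j)\<in>offdiag n. proj2 (x j)) - real (card (offdiag n)) * mean"
    unfolding degen_def by (simp add: case_prod_beta sum.distrib sum_subtractf)
  also have "\<dots> = (\<Sum>(i, j)\<in>offdiag n. degen (x i) (x j))
        + (real n - 1) * (\<Sum>i<n. proj1 (x i) + proj2 (x i) - 2 * mean) + ?N * mean"
    using assms by (simp add: sum_offdiag_fst sum_offdiag_snd card_offdiag sum.distrib
      sum_subtractf of_nat_diff algebra_simps)
  finally have eq: "(\<Sum>(i, j)\<in>offdiag n. h (x i) (x j)) = (\<Sum>(i, j)\<in>offdiag n. degen (x i) (x j))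
        + (real n - 1) * (\<Sum>i<n. proj1 (x i) + proj2 (x i) - 2 * mean) + ?N * mean" .
  have "ustat n x - mean = (\<Sum>(i, j)\<in>offdiag n. degen (x i) (x j)) / ?N
        + (\<Sum>i<n. proj1 (x i) + proj2 (x i) - 2 * mean) / real n"
    unfolding ustat_def eq using N by (simp add: add_divide_distrib)
  moreover have "sqrt (real n) * (y / real n) = y / sqrt (real n)" for y
    by (metis divide_divide_eq_right mult.commute real_div_sqrt of_nat_0_le_iff
        times_divide_eq_left times_divide_eq_right)
  ultimately show ?thesis by (simp add: distrib_left)
qed

end

section \<open>Weak convergence by comparison of characteristic functions\<close>

lemma normal_dist_scale:
  assumes "0 < \<sigma>"
  shows "distr std_normal_distribution borel (\<lambda>x. \<sigma> * x) = normal_dist 0 (\<sigma>\<^sup>2)"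
proof -
  interpret prob_space std_normal_distribution
    using prob_space_normal_density by auto
  have "distributed std_normal_distribution lborel (\<lambda>x. x) (\<lambda>x. ennreal (normal_density 0 1 x))"
    unfolding distributed_def by (auto simp: distr_id2)
  from normal_density_affine[OF this, of \<sigma> 0] assms show ?thesis
    by (auto simp: distributed_def normal_dist_def cong: distr_cong)
qed

lemma real_distribution_normal_dist: "0 < v \<Longrightarrow> real_distribution (normal_dist 0 v)"
  using prob_space_normal_density[of "sqrt v" 0]
  by (auto simp: real_distribution_def real_distribution_axioms_def normal_dist_def)

lemma char_distr_scale:
  assumes "f \<in> borel_measurable M"
  shows "char (distr M borel (\<lambda>x. c * f x)) t = char (distr M borel f) (c * t)"
  using assms by (simp add: char_def integral_distr mult_ac)

text \<open>Factor out the unimodular \<open>iexp b\<close> and use the Taylor bound of order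
  zero.\<close>

lemma cmod_iexp_diff_le: "cmod (iexp a - iexp b) \<le> \<bar>a - b\<bar>"
proof -
  have "iexp a - iexp b = iexp b * (iexp (a - b) - 1)"
    by (simp add: right_diff_distrib exp_add[symmetric])
  then show ?thesis
    using iexp_approx1[of "a - b" 0] by (simp add: norm_mult del: of_real_diff)
qed

lemma (in prob_space) char_distr_diff_le:
  assumes [measurable]: "f \<in> borel_measurable M" "g \<in> borel_measurable M"
    and int: "integrable M (\<lambda>x. f x - g x)"
  shows "cmod (char (distr M borel f) t - char (distr M borel g) t)
    \<le> \<bar>t\<bar> * expectation (\<lambda>x. \<bar>f x - g x\<bar>)"
proof -
  have i: "integrable M (\<lambda>x. iexp (t * u x))" if [measurable]: "u \<in> borel_measurable M" for u
    by (intro integrable_const_bound[where B=1]) auto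
  have "char (distr M borel f) t - char (distr M borel g) t
      = (CLINT x|M. iexp (t * f x) - iexp (t * g x))"
    unfolding char_def Bochner_Integration.integral_diff[OF i[OF assms(1)] i[OF assms(2)]]
    by (subst (1 2) integral_distr) auto
  also have "cmod \<dots> \<le> (\<integral>x. cmod (iexp (t * f x) - iexp (t * g x)) \<partial>M)"
    by (rule integral_norm_bound)
  also have "\<dots> \<le> (\<integral>x. \<bar>t\<bar> * \<bar>f x - g x\<bar> \<partial>M)"
  proof (rule integral_mono)
    show "cmod (iexp (t * f x) - iexp (t * g x)) \<le> \<bar>t\<bar> * \<bar>f x - g x\<bar>" for x
      using cmod_iexp_diff_le[of "t * f x" "t * g x"]
      by (simp add: abs_mult[symmetric] right_diff_distrib)
  qed (use int i in \<open>auto\<close>)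
  finally show ?thesis by simp
qed

text \<open>A Slutsky-type statement for probability spaces that change with \<open>n\<close>:
  characteristic functions are Lipschitz in the L1 distance, so those of \<open>f n\<close> and
  \<open>g n\<close> have the same limit. Integrability is asked for only eventually because the
  decomposition of the U-statistic starts at n = 2.\<close>

lemma weak_conv_m_perturb:
  assumes P: "\<And>n. prob_space (P n)"
    and f: "\<And>n. f n \<in> borel_measurable (P n)" and g: "\<And>n. g n \<in> borel_measurable (P n)"
    and int: "\<forall>\<^sub>F n in sequentially. integrable (P n) (\<lambda>x. f n x - g n x)"
    and lim: "(\<lambda>n. \<integral>x. \<bar>f n x - g n x\<bar> \<partial>P n) \<longlonglongrightarrow> 0"
    and L: "real_distribution L" and conv: "weak_conv_m (\<lambda>n. distr (P n) borel (g n)) L"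
  shows "weak_conv_m (\<lambda>n. distr (P n) borel (f n)) L"
proof (rule levy_continuity)
  have rd: "real_distribution (distr (P n) borel (u n))"
    if "\<And>n. u n \<in> borel_measurable (P n)" for u n
    using prob_space.real_distribution_distr[OF P that] .
  show "real_distribution (distr (P n) borel (f n))" for n by (rule rd[OF f])
  fix t
  have g_lim: "(\<lambda>n. char (distr (P n) borel (g n)) t) \<longlonglongrightarrow> char L t"
    by (rule levy_continuity1[OF rd[OF g] L conv])
  have "(\<lambda>n. char (distr (P n) borel (f n)) t - char (distr (P n) borel (g n)) t) \<longlonglongrightarrow> 0"
  proof (rule Lim_null_comparison)
    show "(\<lambda>n. \<bar>t\<bar> * (\<integral>x. \<bar>f n x - g n x\<bar> \<partial>P n)) \<longlonglongrightarrow> 0"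
      using tendsto_mult_left[OF lim, of "\<bar>t\<bar>"] by simp
    show "\<forall>\<^sub>F n in sequentially.
        cmod (char (distr (P n) borel (f n)) t - char (distr (P n) borel (g n)) t)
          \<le> \<bar>t\<bar> * (\<integral>x. \<bar>f n x - g n x\<bar> \<partial>P n)"
      using int by eventually_elim (rule prob_space.char_distr_diff_le[OF P f g])
  qed
  from tendsto_add[OF this g_lim] show "(\<lambda>n. char (distr (P n) borel (f n)) t) \<longlonglongrightarrow> char L t"
    by simp
qed (rule L)

context bounded_kernel
begin

text \<open>One summand of the projection of the U-statistic; both projections occur because a point
  may be the tail or the head of an arc.\<close>

definition hajek :: "'b \<Rightarrow> real" where "hajek x = proj1 x + proj2 x - 2 * mean"

lemma hajek_measurable [measurable]: "hajek \<in> borel_measurable V"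
  unfolding hajek_def[abs_def] by measurable

lemma hajek_bound: "\<bar>hajek x\<bar> \<le> 4 * B"
  using proj1_bound[of x] proj2_bound[of x] mean_bound unfolding hajek_def by linarith

lemma hajek_expectation: "expectation hajek = 0"
  unfolding hajek_def[abs_def] using proj1_integrable proj2_integrable
  by (simp add: mean_proj2 prob_space flip: mean_def)

lemma ustat_measurable [measurable]: "ustat n \<in> borel_measurable (PiM {..<n} (\<lambda>_. V))"
  unfolding ustat_def[abs_def] case_prod_beta
proof (intro borel_measurable_divide borel_measurable_sum h_meas)
  fix p assume "p \<in> offdiag n"
  then have [measurable]: "fst p \<in> {..<n}" "snd p \<in> {..<n}" by (auto simp: offdiag_def)
  show "(\<lambda>x. x (fst p)) \<in> measurable (PiM {..<n} (\<lambda>_. V)) V"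
    "(\<lambda>x. x (snd p)) \<in> measurable (PiM {..<n} (\<lambda>_. V)) V" by measurable
qed simp

text \<open>The classical theorem concerns one sequence on one space, so it is applied to the
  coordinates of the infinite product; the finite products are its marginals.\<close>

lemma clt_hajek:
  assumes \<sigma>: "0 < \<sigma>" and var: "expectation (\<lambda>x. (hajek x)\<^sup>2) = \<sigma>\<^sup>2"
  shows "weak_conv_m (\<lambda>n. distr (PiM {..<n} (\<lambda>_. V)) borel (\<lambda>x. (\<Sum>i<n. hajek (x i)) / sqrt (real n)))
    (normal_dist 0 (\<sigma>\<^sup>2))"
proof -
  let ?Q = "PiM UNIV (\<lambda>_::nat. V)"
  let ?S = "\<lambda>n x. (\<Sum>i<n. hajek (x i)) / sqrt (real n * \<sigma>\<^sup>2)"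
  have dV: "distr ?Q V (\<lambda>x. x i) = V" for i by (rule P.PiM_component) simp
  have exp_Q: "(\<integral>x. f (x i) \<partial>?Q) = expectation f" if "f \<in> borel_measurable V"
    for f :: "'b \<Rightarrow> real" and i
    using that by (subst dV[of i, symmetric], subst integral_distr) auto
  have ind: "P.P.indep_vars UNIV (\<lambda>_. borel) (\<lambda>i x. hajek (x i)) UNIV"
  proof (rule P.P.indep_vars_compose2[where M'="\<lambda>_. V"])
    show "P.P.indep_vars UNIV (\<lambda>_. V) (\<lambda>i x. x i) UNIV"
      by (subst P.P.indep_vars_iff_distr_eq_PiM) (auto simp: dV restrict_UNIV distr_id2)
  qed simp
  have clt: "weak_conv_m (\<lambda>n. distr ?Q borel (?S n)) std_normal_distribution"
  proof (rule P.P.central_limit_theorem_zero_mean[OF ind _ \<sigma>])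
    show m0: "(\<integral>x. hajek (x i) \<partial>?Q) = 0" for i by (simp add: exp_Q hajek_expectation)
    show "(\<integral>x. (hajek (x i) - (\<integral>x. hajek (x i) \<partial>?Q))\<^sup>2 \<partial>?Q) = \<sigma>\<^sup>2" for i
      unfolding m0 using exp_Q[of "\<lambda>x. (hajek x)\<^sup>2" i] var by simp
    show "integrable ?Q (\<lambda>x. (hajek (x i))\<^sup>2)" for i
    proof (rule P.P.integrable_const_bound[where B="(4 * B)\<^sup>2"])
      show "AE x in ?Q. norm ((hajek (x i))\<^sup>2) \<le> (4 * B)\<^sup>2"
        using power_mono[where n=2, OF hajek_bound] by (intro AE_I2) simp
    qed simp
    show "distr ?Q borel (\<lambda>x. hajek (x i)) = distr V borel hajek" for i
      by (subst (2) dV[of i, symmetric], subst distr_distr) (auto simp: comp_def)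
  qed
  \<comment> \<open>The theorem normalises to variance 1. Multiplying by \<open>\<sigma>\<close>
    rescales the argument of the characteristic function.\<close>
  have "weak_conv_m (\<lambda>n. distr ?Q borel (\<lambda>x. \<sigma> * ?S n x)) (normal_dist 0 (\<sigma>\<^sup>2))"
  proof (rule levy_continuity)
    show "real_distribution (normal_dist 0 (\<sigma>\<^sup>2))"
      using \<sigma> by (intro real_distribution_normal_dist) simp
    show "real_distribution (distr ?Q borel (\<lambda>x. \<sigma> * ?S n x))" for n
      by (rule P.P.real_distribution_distr) simp
    fix t
    have "(\<lambda>n. char (distr ?Q borel (?S n)) (\<sigma> * t)) \<longlonglongrightarrow> char std_normal_distribution (\<sigma> * t)"
      by (rule levy_continuity1[OF _ real_dist_normal_dist clt]) (auto intro!: P.P.real_distribution_distr)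
    also have "char std_normal_distribution (\<sigma> * t) = char (normal_dist 0 (\<sigma>\<^sup>2)) t"
      unfolding normal_dist_scale[OF \<sigma>, symmetric] by (subst char_distr_scale) (auto simp: distr_id2)
    finally show "(\<lambda>n. char (distr ?Q borel (\<lambda>x. \<sigma> * ?S n x)) t) \<longlonglongrightarrow> char (normal_dist 0 (\<sigma>\<^sup>2)) t"
      by (subst char_distr_scale) auto
  qed
  also have "(\<lambda>n. distr ?Q borel (\<lambda>x. \<sigma> * ?S n x))
      = (\<lambda>n. distr (PiM {..<n} (\<lambda>_. V)) borel (\<lambda>x. (\<Sum>i<n. hajek (x i)) / sqrt (real n)))"
  proof
    fix n
    have "distr (PiM {..<n} (\<lambda>_. V)) borel (\<lambda>x. (\<Sum>i<n. hajek (x i)) / sqrt (real n))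
        = distr ?Q borel (\<lambda>x. (\<Sum>i<n. hajek (restrict x {..<n} i)) / sqrt (real n))"
      by (subst P.distr_PiM_restrict_finite[of "{..<n}" UNIV, symmetric])
        (auto simp: comp_def distr_distr intro!: measurable_restrict)
    also have "\<dots> = distr ?Q borel (\<lambda>x. \<sigma> * ?S n x)"
      using \<sigma> by (intro distr_cong) (auto simp: real_sqrt_mult)
    finally show "distr ?Q borel (\<lambda>x. \<sigma> * ?S n x)
        = distr (PiM {..<n} (\<lambda>_. V)) borel (\<lambda>x. (\<Sum>i<n. hajek (x i)) / sqrt (real n))" ..
  qed
  finally show ?thesis .
qed

text \<open>The remainder after the projection tends to 0 in L1, since its L1 norm is at most its L2
  norm, which is of order 1 / sqrt n.\<close>

theorem clt_ustat:
  assumes \<sigma>: "0 < \<sigma>" and var: "expectation (\<lambda>x. (hajek x)\<^sup>2) = \<sigma>\<^sup>2"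
  shows "weak_conv_m (\<lambda>n. distr (PiM {..<n} (\<lambda>_. V)) borel (\<lambda>x. sqrt (real n) * (ustat n x - mean)))
    (normal_dist 0 (\<sigma>\<^sup>2))"
proof (rule weak_conv_m_perturb[OF _ _ _ _ _ _ clt_hajek[OF assms]])
  let ?P = "\<lambda>n. PiM {..<n} (\<lambda>_. V)"
  let ?D = "\<lambda>n x. \<Sum>(i, j)\<in>offdiag n. degen (x i) (x j)"
  let ?c = "\<lambda>n. sqrt (real n) / (real n * (real n - 1))"
  let ?R = "\<lambda>n x. sqrt (real n) * (ustat n x - mean) - (\<Sum>i<n. hajek (x i)) / sqrt (real n)"
  have R: "?R n x = ?c n * ?D n x" if "2 \<le> n" for n x
    unfolding ustat_decomp[OF that] by (simp add: hajek_def)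
  have D_meas [measurable]: "?D n \<in> borel_measurable (?P n)" for n
    unfolding case_prod_beta
  proof (intro borel_measurable_sum degen_measurable)
    fix p assume "p \<in> offdiag n"
    then have [measurable]: "fst p \<in> {..<n}" "snd p \<in> {..<n}" by (auto simp: offdiag_def)
    show "(\<lambda>x. x (fst p)) \<in> measurable (?P n) V" "(\<lambda>x. x (snd p)) \<in> measurable (?P n) V"
      by measurable
  qed
  have D_bound: "\<bar>?D n x\<bar> \<le> real (card (offdiag n)) * (4 * B)" for n x
    unfolding case_prod_beta
    by (rule order_trans[OF sum_abs sum_bounded_above[OF degen_bound]])
  have D_int: "integrable (?P n) (?D n)" for n
    by (rule P.P.integrable_const_bound[where B="real (card (offdiag n)) * (4 * B)"])
      (simp only: real_norm_def D_bound, simp, measurable)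
  have D2_int: "integrable (?P n) (\<lambda>x. (?D n x)\<^sup>2)" for n
  proof (rule P.P.integrable_const_bound[where B="(real (card (offdiag n)) * (4 * B))\<^sup>2"])
    show "AE x in ?P n. norm ((?D n x)\<^sup>2) \<le> (real (card (offdiag n)) * (4 * B))\<^sup>2"
      using power_mono[where n=2, OF D_bound] by (intro AE_I2) simp
  qed measurable
  show "\<forall>\<^sub>F n in sequentially. integrable (?P n) (?R n)"
    using eventually_ge_at_top[of 2]
  proof eventually_elim
    case (elim n) show ?case unfolding R[OF elim] using D_int by simp
  qed
  have bound: "(\<integral>x. \<bar>?R n x\<bar> \<partial>?P n) \<le> sqrt (32 * B\<^sup>2 / (real n - 1))" if n: "2 \<le> n" for n
  proof (rule real_le_rsqrt)
    have "(\<integral>x. \<bar>?D n x\<bar> \<partial>?P n)\<^sup>2 \<le> (\<integral>x. \<bar>?D n x\<bar>\<^sup>2 \<partial>?P n)"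
    proof -
      have "integrable (?P n) (\<lambda>x. \<bar>?D n x\<bar>)" "integrable (?P n) (\<lambda>x. \<bar>?D n x\<bar>\<^sup>2)"
        using D_int D2_int by simp_all
      \<comment> \<open>The variance of the absolute value is nonnegative: this is the comparison of
        the L1 and L2 norms.\<close>
      note eq = P.P.variance_eq[OF this]
      have "0 \<le> (\<integral>x. (\<bar>?D n x\<bar> - (\<integral>x. \<bar>?D n x\<bar> \<partial>?P n))\<^sup>2 \<partial>?P n)"
        by (rule Bochner_Integration.integral_nonneg) simp
      then show ?thesis unfolding eq by (rule diff_ge_0_iff_ge[THEN iffD1])
    qed
    also have "\<dots> \<le> real (n * (n - 1)) * (32 * B\<^sup>2)"
      using degen_sum_second_moment[of n] by simp
    finally have "(?c n)\<^sup>2 * (\<integral>x. \<bar>?D n x\<bar> \<partial>?P n)\<^sup>2 \<le> (?c n)\<^sup>2 * (real (n * (n - 1)) * (32 * B\<^sup>2))"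
      by (rule mult_left_mono) simp
    also have "\<dots> = 32 * B\<^sup>2 / (real n - 1)"
    proof -
      have cancel: "(q / (N * a))\<^sup>2 * (N * a * K) = K / a" if "q\<^sup>2 = N" "N \<noteq> 0" "a \<noteq> 0"
        for q N a K :: real
        using that by (simp add: power_divide power_mult_distrib) (simp add: power2_eq_square)
      have "real (n * (n - 1)) = real n * (real n - 1)" using n by (simp add: of_nat_diff)
      then show ?thesis using cancel[of "sqrt (real n)" "real n" "real n - 1" "32 * B\<^sup>2"] n by simp
    qed
    finally show "(\<integral>x. \<bar>?R n x\<bar> \<partial>?P n)\<^sup>2 \<le> 32 * B\<^sup>2 / (real n - 1)"
      unfolding R[OF n] abs_mult using n by (simp add: power_mult_distrib power_divide)
  qed
  show "(\<lambda>n. \<integral>x. \<bar>?R n x\<bar> \<partial>?P n) \<longlonglongrightarrow> 0"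
  proof (rule Lim_null_comparison)
    have "(\<lambda>n. 32 * B\<^sup>2 / (real n - 1)) \<longlonglongrightarrow> 0" by real_asymp
    from tendsto_real_sqrt[OF this] show "(\<lambda>n. sqrt (32 * B\<^sup>2 / (real n - 1))) \<longlonglongrightarrow> 0" by simp
    show "\<forall>\<^sub>F n in sequentially. norm (\<integral>x. \<bar>?R n x\<bar> \<partial>?P n) \<le> sqrt (32 * B\<^sup>2 / (real n - 1))"
      using eventually_ge_at_top[of 2] by eventually_elim (simp add: bound)
  qed
  show "real_distribution (normal_dist 0 (\<sigma>\<^sup>2))"
    using \<sigma> by (intro real_distribution_normal_dist) simp
qed (auto intro: P.P.prob_space_axioms)

end

section \<open>Conditioning an iid sample on the number of hits of a set\<close>

lemma ennreal_times_divide_cancel: "c \<noteq> 0 \<Longrightarrow> c \<noteq> top \<Longrightarrow> c * (b / c) = (b :: ennreal)"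
  by (simp add: ennreal_times_divide mult.commute[of c] ennreal_mult_divide_eq)

lemma (in prob_space) emeasure_indep_box:
  fixes n :: nat
  assumes ind: "indep_vars (\<lambda>_. S) X UNIV" and D: "\<And>j. distr M S (X j) = D"
    and C: "\<And>j. j < n \<Longrightarrow> C j \<in> sets S"
  shows "emeasure M {\<omega> \<in> space M. \<forall>j<n. X j \<omega> \<in> C j} = (\<Prod>j<n. emeasure D (C j))"
proof (cases "n = 0")
  case True
  then show ?thesis by (simp add: emeasure_space_1)
next
  case False
  have X [measurable]: "X j \<in> measurable M S" for j
    using ind unfolding indep_vars_def by auto
  have "{\<omega> \<in> space M. \<forall>j<n. X j \<omega> \<in> C j} = (\<Inter>j\<in>{..<n}. X j -` C j \<inter> space M)"
    using False by auto
  then have "emeasure M {\<omega> \<in> space M. \<forall>j<n. X j \<omega> \<in> C j}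
      = ennreal (\<Prod>j<n. prob (X j -` C j \<inter> space M))"
    using indep_varsD[OF ind, of "{..<n}" C] False C by (auto simp: emeasure_eq_measure)
  also have "\<dots> = (\<Prod>j<n. emeasure M (X j -` C j \<inter> space M))"
    by (simp add: prod_ennreal emeasure_eq_measure)
  also have "\<dots> = (\<Prod>j<n. emeasure D (C j))"
  proof (rule prod.cong)
    fix j assume "j \<in> {..<n}"
    then show "emeasure M (X j -` C j \<inter> space M) = emeasure D (C j)"
      using C[of j] by (subst D[of j, symmetric], subst emeasure_distr) auto
  qed simp
  finally show ?thesis .
qed

text \<open>Indices rather than values, so coincident observations are counted separately.\<close>

definition hits :: "(nat \<Rightarrow> 'a \<Rightarrow> 'b) \<Rightarrow> 'b set \<Rightarrow> nat \<Rightarrow> 'a \<Rightarrow> nat set" where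
  "hits X I n \<omega> = {j. j < n \<and> X j \<omega> \<in> I}"

lemma finite_hits [simp]: "finite (hits X I n \<omega>)"
  by (simp add: hits_def)

text \<open>The observations are renumbered in increasing order of index, to live on
  \<open>{..<card J}\<close> whatever \<open>J\<close> is. \<open>J\<close> is a parameter, so
  measurability is a question about a fixed index set.\<close>

definition hit_values :: "(nat \<Rightarrow> 'a \<Rightarrow> 'b) \<Rightarrow> nat set \<Rightarrow> 'a \<Rightarrow> nat \<Rightarrow> 'b" where
  "hit_values X J \<omega> = (\<lambda>a\<in>{..<card J}. X (sorted_list_of_set J ! a) \<omega>)"

lemma bij_betw_nth_sorted:
  "finite J \<Longrightarrow> bij_betw (\<lambda>a. sorted_list_of_set J ! a) {..<card J} J"
  by (rule bij_betw_nth) auto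

text \<open>\<open>V_cond\<close> says that \<open>V\<close> is \<open>D\<close> conditioned on
  \<open>I\<close>, in multiplied-out form to avoid division.\<close>

locale conditioned_sample = prob_space M for M :: "'a measure" +
  fixes X :: "nat \<Rightarrow> 'a \<Rightarrow> 'b" and S D V :: "'b measure" and I :: "'b set"
  assumes indep: "indep_vars (\<lambda>_. S) X UNIV"
    and distr_X: "\<And>j. distr M S (X j) = D"
    and I_sets [measurable]: "I \<in> sets S"
    and V_prob: "prob_space V" and sets_V [measurable_cong]: "sets V = sets S"
    and V_cond: "\<And>A. A \<in> sets S \<Longrightarrow> emeasure D (A \<inter> I) = emeasure D I * emeasure V A"
begin

lemma X_measurable [measurable]: "X j \<in> measurable M S"
  using indep unfolding indep_vars_def by auto

lemma hit_values_measurable [measurable]: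
  "hit_values X J \<in> measurable M (PiM {..<card J} (\<lambda>_. V))"
  unfolding hit_values_def[abs_def] by measurable

lemma hits_event [measurable]: "{\<omega> \<in> space M. hits X I n \<omega> = J} \<in> events"
proof -
  have "{\<omega> \<in> space M. hits X I n \<omega> = J} = (if J \<subseteq> {..<n}
      then {\<omega> \<in> space M. \<forall>j\<in>{..<n}. X j \<omega> \<in> I \<longleftrightarrow> j \<in> J} else {})"
    by (auto simp: hits_def)
  then show ?thesis by simp
qed

text \<open>The event that exactly the indices in \<open>J\<close> hit \<open>I\<close> is a box in
  the first n observations, and prescribing a box for the hitting values only shrinks its sides.
  Independence then gives a product on both sides.\<close>

lemma hits_box:
  assumes J: "J \<subseteq> {..<n}" and E: "\<And>a. a < card J \<Longrightarrow> E a \<in> sets S"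
  shows "emeasure M {\<omega> \<in> space M. hits X I n \<omega> = J \<and> hit_values X J \<omega> \<in> PiE {..<card J} E}
    = emeasure M {\<omega> \<in> space M. hits X I n \<omega> = J} * (\<Prod>a<card J. emeasure V (E a))"
proof -
  have fin: "finite J" using J finite_subset by blast
  let ?e = "\<lambda>a. sorted_list_of_set J ! a"
  note bij = bij_betw_nth_sorted[OF fin]
  \<comment> \<open>\<open>r j\<close> is the rank of \<open>j\<close> in \<open>J\<close>, that is,
    the coordinate at which observation \<open>j\<close> appears in
    \<open>hit_values\<close>.\<close>
  define r where "r = the_inv_into {..<card J} ?e"
  have r: "r (?e a) = a" if "a < card J" for a
    unfolding r_def using bij that by (auto simp: bij_betw_def the_inv_into_f_f)
  have e: "?e (r j) = j" "r j < card J" if "j \<in> J" for j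
  proof -
    from that bij obtain a where "a < card J" "j = ?e a" by (auto simp: bij_betw_def)
    with r[of a] show "?e (r j) = j" "r j < card J" by simp_all
  qed
  define C where "C F j = (if j \<in> J then F (r j) \<inter> I else space S - I)" for F :: "nat \<Rightarrow> 'b set" and j
  have C_sets: "C F j \<in> sets S" if "\<And>a. a < card J \<Longrightarrow> F a \<in> sets S" for F j
    unfolding C_def using that e by auto
  have split: "(\<Prod>j<n. emeasure D (C F j)) = (\<Prod>j\<in>{..<n} - J. emeasure D (space S - I))
      * (emeasure D I ^ card J * (\<Prod>a<card J. emeasure V (F a)))"
    if F: "\<And>a. a < card J \<Longrightarrow> F a \<in> sets S" for F
  proof -
    have "(\<Prod>j<n. emeasure D (C F j))
        = (\<Prod>j\<in>{..<n} - J. emeasure D (C F j)) * (\<Prod>j\<in>J. emeasure D (C F j))"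
      using J by (intro prod.subset_diff) auto
    also have "(\<Prod>j\<in>{..<n} - J. emeasure D (C F j)) = (\<Prod>j\<in>{..<n} - J. emeasure D (space S - I))"
      by (rule prod.cong) (auto simp: C_def)
    also have "(\<Prod>j\<in>J. emeasure D (C F j)) = (\<Prod>j\<in>J. emeasure D I * emeasure V (F (r j)))"
      using e F by (intro prod.cong) (auto simp: C_def V_cond)
    also have "\<dots> = emeasure D I ^ card J * (\<Prod>j\<in>J. emeasure V (F (r j)))"
      by (simp add: prod.distrib)
    also have "(\<Prod>j\<in>J. emeasure V (F (r j))) = (\<Prod>a<card J. emeasure V (F (r (?e a))))"
      by (rule prod.reindex_bij_betw[OF bij, symmetric])
    also have "\<dots> = (\<Prod>a<card J. emeasure V (F a))"
      by (rule prod.cong) (auto simp: r)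
    finally show ?thesis .
  qed
  have X_sp: "X j \<omega> \<in> space S" if "\<omega> \<in> space M" for j \<omega>
    using measurable_space[OF X_measurable that] .
  have hit_iff: "hits X I n \<omega> = J \<and> (\<forall>j\<in>J. X j \<omega> \<in> F (r j)) \<longleftrightarrow> (\<forall>j<n. X j \<omega> \<in> C F j)"
    if "\<omega> \<in> space M" for F \<omega>
    using J X_sp[OF that] by (auto simp: hits_def C_def split: if_splits)
  have values_iff: "hit_values X J \<omega> \<in> PiE {..<card J} E \<longleftrightarrow> (\<forall>j\<in>J. X j \<omega> \<in> E (r j))" for \<omega>
  proof -
    have "hit_values X J \<omega> \<in> PiE {..<card J} E \<longleftrightarrow> (\<forall>a<card J. X (?e a) \<omega> \<in> E (r (?e a)))"
      by (auto simp: hit_values_def PiE_iff r)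
    also have "\<dots> \<longleftrightarrow> (\<forall>j\<in>?e ` {..<card J}. X j \<omega> \<in> E (r j))" by auto
    finally show ?thesis unfolding bij_betw_imp_surj_on[OF bij] .
  qed
  have "{\<omega> \<in> space M. hits X I n \<omega> = J \<and> hit_values X J \<omega> \<in> PiE {..<card J} E}
      = {\<omega> \<in> space M. \<forall>j<n. X j \<omega> \<in> C E j}"
    using hit_iff[of _ E] by (auto simp: values_iff)
  moreover have "{\<omega> \<in> space M. hits X I n \<omega> = J} = {\<omega> \<in> space M. \<forall>j<n. X j \<omega> \<in> C (\<lambda>_. space S) j}"
    using hit_iff[of _ "\<lambda>_. space S"] X_sp by auto
  moreover have "emeasure M {\<omega> \<in> space M. \<forall>j<n. X j \<omega> \<in> C F j}
      = ((\<Prod>j\<in>{..<n} - J. emeasure D (space S - I)) * emeasure D I ^ card J) * (\<Prod>a<card J. emeasure V (F a))"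
    if F: "\<And>a. a < card J \<Longrightarrow> F a \<in> sets S" for F
    using emeasure_indep_box[where C="C F" and n=n, OF indep distr_X C_sets[OF F]] split[OF F]
    by (simp only: mult.assoc)
  \<comment> \<open>The same formula with full sides computes the probability of the hitting event,
    since \<open>V\<close> has mass 1; the common factors are then identified.\<close>
  note this[OF E] this[OF sets.top]
  moreover have "(\<Prod>a<card J. emeasure V (space S)) = 1"
    using prob_space.emeasure_space_1[OF V_prob] sets_eq_imp_space_eq[OF sets_V] by simp
  ultimately show ?thesis by (simp only: mult_1_right)
qed

text \<open>Boxes determine a product measure, so the box formula extends to all measurable sets
  after division by the probability of the hitting event. If that probability is 0, both sides
  vanish.\<close>

lemma hits_law:
  assumes J: "J \<subseteq> {..<n}" and B: "B \<in> sets (PiM {..<card J} (\<lambda>_. V))"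
  shows "emeasure M {\<omega> \<in> space M. hits X I n \<omega> = J \<and> hit_values X J \<omega> \<in> B}
    = emeasure M {\<omega> \<in> space M. hits X I n \<omega> = J} * emeasure (PiM {..<card J} (\<lambda>_. V)) B"
proof (cases "emeasure M {\<omega> \<in> space M. hits X I n \<omega> = J} = 0")
  case True
  have "emeasure M {\<omega> \<in> space M. hits X I n \<omega> = J \<and> hit_values X J \<omega> \<in> B}
      \<le> emeasure M {\<omega> \<in> space M. hits X I n \<omega> = J}"
    by (rule emeasure_mono) auto
  with True show ?thesis by simp
next
  case False
  let ?A = "{\<omega> \<in> space M. hits X I n \<omega> = J}" and ?P = "PiM {..<card J} (\<lambda>_. V)"
  let ?U = "uniform_measure M ?A"
  interpret V: prob_space V by (rule V_prob)
  interpret P: product_sigma_finite "\<lambda>_. V" ..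
  have U: "emeasure (distr ?U ?P (hit_values X J)) B'
      = emeasure M {\<omega> \<in> space M. hits X I n \<omega> = J \<and> hit_values X J \<omega> \<in> B'} / emeasure M ?A"
    if B': "B' \<in> sets ?P" for B'
  proof -
    have "hit_values X J -` B' \<inter> space M \<in> events" using B' by measurable
    moreover have "?A \<inter> (hit_values X J -` B' \<inter> space M)
        = {\<omega> \<in> space M. hits X I n \<omega> = J \<and> hit_values X J \<omega> \<in> B'}" by auto
    ultimately show ?thesis using B' by (simp add: emeasure_distr)
  qed
  have "distr ?U ?P (hit_values X J) = ?P"
  proof (rule P.PiM_eqI)
    fix E assume E: "\<And>a. a \<in> {..<card J} \<Longrightarrow> E a \<in> sets V"
    then have "emeasure (distr ?U ?P (hit_values X J)) (PiE {..<card J} E)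
        = emeasure M ?A * (\<Prod>a<card J. emeasure V (E a)) / emeasure M ?A"
      by (subst U) (auto intro!: sets_PiM_I_finite simp: hits_box[OF J] sets_V)
    also have "\<dots> = (\<Prod>a<card J. emeasure V (E a))"
      using False by (simp add: ennreal_mult_divide_eq mult.commute)
    finally show "emeasure (distr ?U ?P (hit_values X J)) (PiE {..<card J} E)
        = (\<Prod>a<card J. emeasure V (E a))" .
  qed auto
  then have "emeasure ?P B
      = emeasure M {\<omega> \<in> space M. hits X I n \<omega> = J \<and> hit_values X J \<omega> \<in> B} / emeasure M ?A"
    using U[OF B] by simp
  then show ?thesis using False by (simp add: ennreal_times_divide_cancel)
qed

text \<open>The conditional law given the index set depends only on its cardinality, so it survives
  summation over the finitely many disjoint events for k-subsets.\<close>

lemma hits_card_law: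
  assumes B: "B \<in> sets (PiM {..<k} (\<lambda>_. V))"
  shows "emeasure M {\<omega> \<in> space M. card (hits X I n \<omega>) = k \<and> hit_values X (hits X I n \<omega>) \<omega> \<in> B}
    = emeasure M {\<omega> \<in> space M. card (hits X I n \<omega>) = k} * emeasure (PiM {..<k} (\<lambda>_. V)) B"
    and "{\<omega> \<in> space M. card (hits X I n \<omega>) = k \<and> hit_values X (hits X I n \<omega>) \<omega> \<in> B} \<in> events"
    and "{\<omega> \<in> space M. card (hits X I n \<omega>) = k} \<in> events"
proof -
  let ?L = "{\<omega> \<in> space M. card (hits X I n \<omega>) = k \<and> hit_values X (hits X I n \<omega>) \<omega> \<in> B}"
  let ?R = "{\<omega> \<in> space M. card (hits X I n \<omega>) = k}"
  let ?\<J> = "{J. J \<subseteq> {..<n} \<and> card J = k}"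
  let ?A = "\<lambda>J. {\<omega> \<in> space M. hits X I n \<omega> = J}"
  let ?AB = "\<lambda>J. {\<omega> \<in> space M. hits X I n \<omega> = J \<and> hit_values X J \<omega> \<in> B}"
  have fin: "finite ?\<J>" by (rule finite_subset[of _ "Pow {..<n}"]) auto
  have L: "?L = (\<Union>J\<in>?\<J>. ?AB J)" and R: "?R = (\<Union>J\<in>?\<J>. ?A J)"
    by (auto simp: hits_def)
  have AB: "?AB J \<in> events" if "J \<in> ?\<J>" for J
  proof -
    have "?AB J = ?A J \<inter> (hit_values X J -` B \<inter> space M)" by auto
    also have "\<dots> \<in> events"
      using B that hit_values_measurable[of J] by (intro sets.Int hits_event measurable_sets) auto
    finally show ?thesis .
  qed
  show "?L \<in> events" unfolding L using fin AB by auto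
  show "?R \<in> events" unfolding R using fin by auto
  have "emeasure M ?L = (\<Sum>J\<in>?\<J>. emeasure M (?AB J))"
    unfolding L using fin AB
    by (intro sum_emeasure[symmetric]) (auto simp: disjoint_family_on_def)
  also have "\<dots> = (\<Sum>J\<in>?\<J>. emeasure M (?A J) * emeasure (PiM {..<k} (\<lambda>_. V)) B)"
    using B by (intro sum.cong) (auto simp: hits_law)
  also have "\<dots> = (\<Sum>J\<in>?\<J>. emeasure M (?A J)) * emeasure (PiM {..<k} (\<lambda>_. V)) B"
    by (rule sum_distrib_right[symmetric])
  also have "(\<Sum>J\<in>?\<J>. emeasure M (?A J)) = emeasure M ?R"
    unfolding R using fin by (intro sum_emeasure) (auto simp: disjoint_family_on_def)
  finally show "emeasure M ?L = emeasure M ?R * emeasure (PiM {..<k} (\<lambda>_. V)) B" .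
qed

text \<open>One favourable box suffices: the first \<open>k\<close> observations inside
  \<open>I\<close>, the others outside.\<close>

lemma emeasure_hits_pos:
  assumes "k \<le> n" "emeasure D I \<noteq> 0" "emeasure D (space S - I) \<noteq> 0"
  shows "emeasure M {\<omega> \<in> space M. card (hits X I n \<omega>) = k} \<noteq> 0"
proof
  assume z: "emeasure M {\<omega> \<in> space M. card (hits X I n \<omega>) = k} = 0"
  let ?C = "\<lambda>j. if j < k then I else space S - I"
  have "{\<omega> \<in> space M. \<forall>j<n. X j \<omega> \<in> ?C j} \<subseteq> {\<omega> \<in> space M. card (hits X I n \<omega>) = k}"
  proof safe
    fix \<omega> assume *: "\<forall>j<n. X j \<omega> \<in> ?C j"
    then have "hits X I n \<omega> = {..<k}" using \<open>k \<le> n\<close> by (fastforce simp: hits_def split: if_splits)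
    then show "card (hits X I n \<omega>) = k" by simp
  qed
  then have "emeasure M {\<omega> \<in> space M. \<forall>j<n. X j \<omega> \<in> ?C j}
      \<le> emeasure M {\<omega> \<in> space M. card (hits X I n \<omega>) = k}"
    by (rule emeasure_mono) (rule hits_card_law(3)[OF sets.top])
  then have "emeasure M {\<omega> \<in> space M. \<forall>j<n. X j \<omega> \<in> ?C j} = 0"
    unfolding z le_zero_eq .
  moreover have "emeasure M {\<omega> \<in> space M. \<forall>j<n. X j \<omega> \<in> ?C j} = (\<Prod>j<n. emeasure D (?C j))"
    by (rule emeasure_indep_box[OF indep distr_X]) auto
  ultimately show False using assms by (auto simp: prod_zero_iff split: if_splits)
qed

text \<open>The event and the statistic need to match the index description only almost surely,
  which leaves room for coincident observations.\<close>

theorem distr_given_card: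
  assumes E: "E \<in> events" and E_AE: "AE \<omega> in M. \<omega> \<in> E \<longleftrightarrow> card (hits X I n \<omega>) = k"
    and pos: "emeasure M E \<noteq> 0"
    and T: "T \<in> borel_measurable M" and G: "G \<in> borel_measurable (PiM {..<k} (\<lambda>_. V))"
    and T_AE: "AE \<omega> in M. card (hits X I n \<omega>) = k \<longrightarrow> T \<omega> = G (hit_values X (hits X I n \<omega>) \<omega>)"
  shows "distr (uniform_measure M E) borel T = distr (PiM {..<k} (\<lambda>_. V)) borel G"
proof (rule measure_eqI)
  fix B assume "B \<in> sets (distr (uniform_measure M E) borel T)"
  then have B: "B \<in> sets borel" by simp
  let ?P = "PiM {..<k} (\<lambda>_. V)"
  let ?R = "{\<omega> \<in> space M. card (hits X I n \<omega>) = k}"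
  let ?GB = "G -` B \<inter> space ?P"
  let ?L = "{\<omega> \<in> space M. card (hits X I n \<omega>) = k \<and> hit_values X (hits X I n \<omega>) \<omega> \<in> ?GB}"
  have GB: "?GB \<in> sets ?P" using G B by (rule measurable_sets)
  have TB: "T -` B \<inter> space M \<in> events" using T B by (rule measurable_sets)
  have ER: "emeasure M E = emeasure M ?R"
    using E_AE hits_card_law(3)[OF GB] E by (intro emeasure_eq_AE) auto
  have "emeasure M (E \<inter> (T -` B \<inter> space M)) = emeasure M ?L"
  proof (rule emeasure_eq_AE)
    show "AE \<omega> in M. \<omega> \<in> E \<inter> (T -` B \<inter> space M) \<longleftrightarrow> \<omega> \<in> ?L"
      using E_AE T_AE
    proof eventually_elim
      case (elim \<omega>)
      have "hit_values X (hits X I n \<omega>) \<omega> \<in> space ?P"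
        if "\<omega> \<in> space M" "card (hits X I n \<omega>) = k"
        using measurable_space[OF hit_values_measurable[of "hits X I n \<omega>"] that(1)] that(2) by simp
      with elim show ?case using sets.sets_into_space[OF E] by auto
    qed
  qed (use E TB hits_card_law(2)[OF GB] in auto)
  also note hits_card_law(1)[OF GB]
  finally have "emeasure (distr (uniform_measure M E) borel T) B
      = emeasure M ?R * emeasure ?P ?GB / emeasure M ?R"
    using B T E TB by (simp add: emeasure_distr ER)
  also have "\<dots> = emeasure ?P ?GB"
    using pos ER by (simp add: ennreal_mult_divide_eq mult.commute)
  finally show "emeasure (distr (uniform_measure M E) borel T) B = emeasure (distr ?P borel G) B"
    using G B by (simp add: emeasure_distr)
qed simp

end

section \<open>Points and arcs of a sample\<close>

text \<open>Injectivity carries arcs back to index pairs and turns distinctness of vertices into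
  distinctness of indices.\<close>

lemma card_arcs_image:
  assumes inj: "inj_on f F" and F: "F \<subseteq> {..<n}"
  shows "real (card {(u, v). u \<in> f ` F \<and> v \<in> f ` F \<and> u \<noteq> v \<and> R u v})
    = (\<Sum>(i, j)\<in>offdiag n. of_bool (i \<in> F \<and> j \<in> F \<and> R (f i) (f j)))"
proof -
  let ?P = "{(i, j). (i, j) \<in> offdiag n \<and> i \<in> F \<and> j \<in> F \<and> R (f i) (f j)}"
  have "inj_on (map_prod f f) ?P"
    by (rule inj_on_subset[OF map_prod_inj_on[OF inj inj]]) auto
  moreover have "{(u, v). u \<in> f ` F \<and> v \<in> f ` F \<and> u \<noteq> v \<and> R u v} = map_prod f f ` ?P"
    using inj F by (force simp: offdiag_def image_iff inj_on_def)
  ultimately have "card {(u, v). u \<in> f ` F \<and> v \<in> f ` F \<and> u \<noteq> v \<and> R u v} = card ?P"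
    by (simp add: card_image)
  moreover have "?P = offdiag n \<inter> {p. case p of (i, j) \<Rightarrow> i \<in> F \<and> j \<in> F \<and> R (f i) (f j)}"
    by auto
  ultimately show ?thesis
    by (simp add: case_prod_beta of_bool_def sum.If_cases)
qed

text \<open>A sample is a set, so coincident observations collapse. Counting first occurrences
  gives the number of points and arcs on every outcome, which makes the statistic measurable and
  not just almost surely equal to a measurable function.\<close>

definition first_hits :: "(nat \<Rightarrow> 'b) \<Rightarrow> 'b set \<Rightarrow> nat \<Rightarrow> nat set" where
  "first_hits f I n = {j. j < n \<and> f j \<in> I \<and> (\<forall>l<j. f l \<noteq> f j)}"

lemma first_hits_inj: "inj_on f (first_hits f I n)"
  unfolding inj_on_def first_hits_def by (metis (mono_tags, lifting) mem_Collect_eq nat_neq_iff)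

lemma first_hits_subset: "first_hits f I n \<subseteq> {..<n}"
  by (auto simp: first_hits_def)

lemma first_hits_image: "f ` first_hits f I n = f ` {..<n} \<inter> I"
proof
  show "f ` {..<n} \<inter> I \<subseteq> f ` first_hits f I n"
  proof
    fix y assume y: "y \<in> f ` {..<n} \<inter> I"
    then obtain j where j: "j < n" "f j = y" by auto
    then obtain l where l: "f l = y" "\<forall>l'<l. f l' \<noteq> y"
      using exists_least_iff[of "\<lambda>l. f l = y"] by blast
    have "\<not> j < l" using l(2) j(2) by blast
    then have "l < n" using j(1) by linarith
    with l have "l \<in> first_hits f I n" using y by (simp add: first_hits_def)
    with l(1) show "y \<in> f ` first_hits f I n" by blast
  qed
qed (auto simp: first_hits_def)

lemma first_hits_measurable:
  fixes X :: "nat \<Rightarrow> 'a \<Rightarrow> real"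
  assumes [measurable]: "\<And>j. X j \<in> borel_measurable M" "I \<in> sets borel"
  shows "Measurable.pred M (\<lambda>\<omega>. j \<in> first_hits (\<lambda>j. X j \<omega>) I n)"
  unfolding first_hits_def by simp

text \<open>By independence the joint law is a product, and each section of the diagonal is a single
  point, null for the law of \<open>Z\<close>.\<close>

lemma (in prob_space) AE_distinct_pair:
  fixes Y Z :: "'a \<Rightarrow> real"
  assumes ind: "indep_var borel Y borel Z"
    and atomless: "\<And>x. emeasure (distr M borel Z) {x} = 0"
  shows "AE \<omega> in M. Y \<omega> \<noteq> Z \<omega>"
proof -
  have [measurable]: "Y \<in> borel_measurable M" "Z \<in> borel_measurable M"
    using ind unfolding indep_var_distribution_eq by auto
  interpret DY: prob_space "distr M borel Y" by (rule prob_space_distr) simp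
  interpret DZ: prob_space "distr M borel Z" by (rule prob_space_distr) simp
  interpret YZ: pair_prob_space "distr M borel Y" "distr M borel Z" ..
  have "AE p in distr M borel Y \<Otimes>\<^sub>M distr M borel Z. fst p \<noteq> snd p"
  proof (rule YZ.AE_pair_measure)
    have "{p \<in> space (borel \<Otimes>\<^sub>M borel). fst p \<noteq> (snd p :: real)} \<in> sets (borel \<Otimes>\<^sub>M borel)"
      by measurable
    then show "{p \<in> space (distr M borel Y \<Otimes>\<^sub>M distr M borel Z). fst p \<noteq> snd p}
        \<in> sets (distr M borel Y \<Otimes>\<^sub>M distr M borel Z)"
      by (simp add: space_pair_measure cong: sets_pair_measure_cong)
    show "AE x in distr M borel Y. AE y in distr M borel Z. fst (x, y) \<noteq> snd (x, y)"
    proof (rule AE_I2)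
      fix x show "AE y in distr M borel Z. fst (x, y) \<noteq> snd (x, y)"
        by (rule AE_I[of _ _ "{x}"]) (auto simp: atomless)
    qed
  qed
  then have "AE p in distr M (borel \<Otimes>\<^sub>M borel) (\<lambda>\<omega>. (Y \<omega>, Z \<omega>)). fst p \<noteq> snd p"
    using ind unfolding indep_var_distribution_eq by metis
  then show ?thesis by (subst (asm) AE_distr_iff) auto
qed

lemma (in prob_space) AE_inj_on_sample:
  fixes X :: "nat \<Rightarrow> 'a \<Rightarrow> real"
  assumes ind: "indep_vars (\<lambda>_. borel) X UNIV"
    and atomless: "\<And>j x. emeasure (distr M borel (X j)) {x} = 0"
  shows "AE \<omega> in M. inj (\<lambda>j. X j \<omega>)"
proof -
  have "AE \<omega> in M. i \<noteq> j \<longrightarrow> X i \<omega> \<noteq> X j \<omega>" for i j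
  proof (cases "i = j")
    case False
    \<comment> \<open>Independence of two members of the family is read off from the disjoint index
      blocks \<open>{i}\<close> and \<open>{j}\<close>.\<close>
    have "indep_var borel ((\<lambda>f. f i) \<circ> (\<lambda>\<omega>. restrict (\<lambda>i. X i \<omega>) {i}))
        borel ((\<lambda>f. f j) \<circ> (\<lambda>\<omega>. restrict (\<lambda>i. X i \<omega>) {j}))"
      using False
      by (intro indep_var_compose[OF indep_var_restrict[OF indep_vars_subset[OF ind, of "{i, j}"]]]) auto
    then have "indep_var borel (X i) borel (X j)" by (simp add: comp_def)
    from AE_distinct_pair[OF this atomless] show ?thesis by auto
  qed simp
  then have "AE \<omega> in M. \<forall>i j. i \<noteq> j \<longrightarrow> X i \<omega> \<noteq> X j \<omega>"
    by (simp add: AE_all_countable)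
  then show ?thesis by eventually_elim (auto simp: inj_def)
qed

section \<open>Moments on the unit interval\<close>

abbreviation U01 :: "real measure" where "U01 \<equiv> uniform_measure lborel {0<..<1}"

lemma prob_space_U01: "prob_space U01"
  by (rule prob_space_uniform_measure) auto

lemma affine_image_borel:
  fixes e w :: real
  assumes "w \<noteq> 0"
  shows "(\<lambda>u. e + w * u) ` {0<..<1} \<in> sets borel"
proof -
  have "(\<lambda>u. e + w * u) ` {0<..<1} = {x \<in> space borel. (x - e) / w \<in> {0<..<1}}"
    using assms by (auto simp: image_iff intro!: bexI[where x="(_ - e) / w"])
  then show ?thesis by simp
qed

text \<open>Lebesgue measure scales by the absolute value of \<open>w\<close>, which cancels on
  normalising. Negative \<open>w\<close>, a reflection, is needed for the left end interval.\<close>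

lemma uniform_measure_affine:
  fixes e w :: real
  assumes w: "w \<noteq> 0"
  shows "uniform_measure lborel ((\<lambda>u. e + w * u) ` {0<..<1}) = distr U01 borel (\<lambda>u. e + w * u)"
proof (rule measure_eqI)
  let ?\<phi> = "\<lambda>u. e + w * u"
  let ?I = "?\<phi> ` {0<..<1}"
  fix B :: "real set" assume "B \<in> sets (uniform_measure lborel ?I)"
  then have B [measurable]: "B \<in> sets borel" by simp
  have I [measurable]: "?I \<in> sets borel" by (rule affine_image_borel[OF w])
  have scale: "emeasure lborel A = ennreal \<bar>w\<bar> * emeasure lborel (?\<phi> -` A)" if [measurable]: "A \<in> sets borel" for A
    by (subst lborel_real_affine[OF w, of e])
      (simp add: emeasure_density nn_integral_cmult emeasure_distr)
  have pre: "?\<phi> -` ?I = {0<..<1}" using w by (auto simp: image_iff)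
  have preB: "?\<phi> -` (?I \<inter> B) = {0<..<1} \<inter> ?\<phi> -` B" unfolding vimage_Int pre ..
  have "emeasure (uniform_measure lborel ?I) B = emeasure lborel (?I \<inter> B) / emeasure lborel ?I"
    by (rule emeasure_uniform_measure) (use I B in simp_all)
  also have "\<dots> = emeasure lborel ({0<..<1} \<inter> ?\<phi> -` B) * ennreal \<bar>w\<bar> / ennreal \<bar>w\<bar>"
    using scale[OF I] scale[OF sets.Int[OF I B]] unfolding pre preB by (simp add: mult.commute)
  also have "\<dots> = emeasure lborel ({0<..<1} \<inter> ?\<phi> -` B)"
    using w by (intro ennreal_mult_divide_eq) auto
  also have "\<dots> = emeasure (distr U01 borel ?\<phi>) B"
  proof -
    have "?\<phi> -` B \<in> sets lborel"
      using measurable_sets[of ?\<phi> borel borel B] by simp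
    then show ?thesis by (simp add: emeasure_distr divide_ennreal_def)
  qed
  finally show "emeasure (uniform_measure lborel ?I) B = emeasure (distr U01 borel ?\<phi>) B" .
qed simp

text \<open>For c > 0 and nonnegative \<open>x\<close>, the distribution function of the uniform law
  on (0, c).\<close>

definition ramp :: "real \<Rightarrow> real \<Rightarrow> real" where
  "ramp c x = (if x < c then x / c else 1)"

lemma ramp_measurable [measurable]: "ramp c \<in> borel_measurable borel"
  unfolding ramp_def[abs_def] by measurable

lemma ramp_bounds: "0 \<le> c \<Longrightarrow> 0 \<le> x \<Longrightarrow> 0 \<le> ramp c x \<and> ramp c x \<le> 1"
  by (auto simp: ramp_def divide_simps)

lemma expectation_U01:
  fixes f :: "real \<Rightarrow> real"
  assumes [measurable]: "f \<in> borel_measurable borel" and bd: "\<And>x. x \<in> {0..1} \<Longrightarrow> \<bar>f x\<bar> \<le> C"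
    and I: "(f has_integral I) {0..1}"
  shows "integral\<^sup>L U01 f = I" and "integrable U01 f"
proof -
  have U: "U01 = density lborel (\<lambda>x. ennreal (indicator {0<..<1} x))"
    unfolding uniform_measure_def
    by (rule density_cong) (auto simp: divide_ennreal_def split: split_indicator)
  have int: "set_integrable lborel {0<..<1} f"
    unfolding set_integrable_def
    by (rule integrableI_bounded_set[where A="{0<..<1}" and B=C]) (auto intro!: bd AE_I2 split: split_indicator)
  then show "integrable U01 f"
    unfolding U set_integrable_def by (subst integrable_density) auto
  have "integral\<^sup>L U01 f = (LINT x:{0<..<1}|lborel. f x)"
    unfolding U set_lebesgue_integral_def by (subst integral_density) auto
  also have "\<dots> = integral {0<..<1} f"
    by (rule set_borel_integral_eq_integral(2)[OF int])
  also have "\<dots> = I"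
    using I unfolding has_integral_Icc_iff_Ioo by (rule integral_unique)
  finally show "integral\<^sup>L U01 f = I" .
qed

text \<open>Split at the two kinks: the integrand is x^2 / (r s) up to \<open>r\<close>, then x / s
  up to \<open>s\<close>, then 1. For r = 0 the first piece is a point.\<close>

lemma has_integral_ramp_mult:
  assumes r: "0 \<le> r" and rs: "r \<le> s" and s: "0 < s" "s \<le> 1"
  shows "((\<lambda>x. ramp r x * ramp s x) has_integral (1 - s / 2 - r\<^sup>2 / (6 * s))) {0..1}"
proof -
  have 1: "((\<lambda>x. ramp r x * ramp s x) has_integral r\<^sup>2 / (3 * s)) {0..r}"
  proof (cases "r = 0")
    case False
    have "((\<lambda>x. x\<^sup>2 / (r * s)) has_integral (r ^ 3 / (3 * r * s) - 0 ^ 3 / (3 * r * s))) {0..r}"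
      using False s r
      by (intro fundamental_theorem_of_calculus) (auto intro!: derivative_eq_intros
        simp: has_real_derivative_iff_has_vector_derivative[symmetric] field_simps power2_eq_square power3_eq_cube)
    moreover have "r ^ 3 / (3 * r * s) - 0 ^ 3 / (3 * r * s) = r\<^sup>2 / (3 * s)"
      using False s by (simp add: field_simps power2_eq_square power3_eq_cube)
    moreover have "x\<^sup>2 / (r * s) = ramp r x * ramp s x" if "x \<in> {0..r}" for x
      using that rs s r False by (auto simp: ramp_def power2_eq_square)
    ultimately show ?thesis by (metis (no_types, lifting) has_integral_cong)
  qed auto
  have 2: "((\<lambda>x. ramp r x * ramp s x) has_integral (s\<^sup>2 - r\<^sup>2) / (2 * s)) {r..s}"
  proof -
    have "((\<lambda>x. x / s) has_integral (s\<^sup>2 / (2 * s) - r\<^sup>2 / (2 * s))) {r..s}"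
      using s rs
      by (intro fundamental_theorem_of_calculus) (auto intro!: derivative_eq_intros
        simp: has_real_derivative_iff_has_vector_derivative[symmetric])
    moreover have "s\<^sup>2 / (2 * s) - r\<^sup>2 / (2 * s) = (s\<^sup>2 - r\<^sup>2) / (2 * s)" by (simp add: diff_divide_distrib)
    moreover have "x / s = ramp r x * ramp s x" if "x \<in> {r..s}" for x
      using that s by (auto simp: ramp_def)
    ultimately show ?thesis by (metis (no_types, lifting) has_integral_cong)
  qed
  have 3: "((\<lambda>x. ramp r x * ramp s x) has_integral 1 - s) {s..1}"
  proof -
    have "((\<lambda>x. 1 :: real) has_integral 1 - s) {s..1}"
      using has_integral_const_real[of "1 :: real" s 1] s by simp
    moreover have "1 = ramp r x * ramp s x" if "x \<in> {s..1}" for x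
      using that rs by (auto simp: ramp_def)
    ultimately show ?thesis by (metis (no_types, lifting) has_integral_cong)
  qed
  have "((\<lambda>x. ramp r x * ramp s x) has_integral r\<^sup>2 / (3 * s) + (s\<^sup>2 - r\<^sup>2) / (2 * s) + (1 - s)) {0..1}"
    using r rs s by (intro has_integral_combine[OF _ _ has_integral_combine[OF _ _ 1 2] 3]) auto
  moreover have "r\<^sup>2 / (3 * s) + (s\<^sup>2 - r\<^sup>2) / (2 * s) + (1 - s) = 1 - s / 2 - r\<^sup>2 / (6 * s)"
    using s by (simp add: field_simps power2_eq_square)
  ultimately show ?thesis by simp
qed

lemma expectation_ramp_mult:
  assumes "0 \<le> r" "r \<le> s" "0 < s" "s \<le> 1"
  shows "(\<integral>x. ramp r x * ramp s x \<partial>U01) = 1 - s / 2 - r\<^sup>2 / (6 * s)"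
    and "integrable U01 (\<lambda>x. ramp r x * ramp s x)"
proof -
  have bd: "\<bar>ramp r x * ramp s x\<bar> \<le> 1" if "x \<in> {0..1}" for x
    using ramp_bounds[of r x] ramp_bounds[of s x] that assms
    by (auto simp: abs_mult intro!: mult_le_one)
  note e = expectation_U01[OF _ bd has_integral_ramp_mult[OF assms]]
  show "(\<integral>x. ramp r x * ramp s x \<partial>U01) = 1 - s / 2 - r\<^sup>2 / (6 * s)"
    "integrable U01 (\<lambda>x. ramp r x * ramp s x)"
    by (rule e; measurable)+
qed

lemma AE_U01: "(\<And>x. 0 < x \<Longrightarrow> x < 1 \<Longrightarrow> P x) \<Longrightarrow> AE x in U01. P x"
  by (rule AE_uniform_measureI) auto

text \<open>On the unit interval an arc from \<open>u\<close> to \<open>v\<close> means \<open>\<bar>v - u\<bar> < \<tau> u\<close>. The probability of such an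
  arc, given \<open>u\<close> or given \<open>v\<close>, is \<open>ramp (hi \<tau>) u - lo \<tau> * u\<close> or \<open>ramp (lo \<tau>) v - hi \<tau> * v\<close>; writing
  \<open>u = ramp 1 u\<close>, all moments reduce to those of products of two ramps. The two ranges of \<open>\<tau>\<close>
  are merged because \<open>ramp 0\<close> is the constant \<open>1\<close> on the unit interval.\<close>

definition lo :: "real \<Rightarrow> real" where "lo \<tau> = max 0 (1 - \<tau>)"
definition hi :: "real \<Rightarrow> real" where "hi \<tau> = 1 / (1 + \<tau>)"

lemma lo_hi:
  assumes "0 < \<tau>" shows "0 \<le> lo \<tau>" "lo \<tau> \<le> hi \<tau>" "0 < hi \<tau>" "hi \<tau> \<le> 1" "lo \<tau> \<le> 1"
  using assms by (auto simp: lo_def hi_def field_simps)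

lemma ramp_one: "x < 1 \<Longrightarrow> ramp 1 x = x" by (simp add: ramp_def)
lemma ramp_zero: "0 < x \<Longrightarrow> ramp 0 x = 1" by (simp add: ramp_def)

lemma expectation_ramp:
  assumes "0 \<le> s" "s \<le> 1"
  shows "(\<integral>x. ramp s x \<partial>U01) = 1 - s / 2" and "integrable U01 (ramp s)"
proof -
  interpret prob_space U01 by (rule prob_space_U01)
  show "integrable U01 (ramp s)"
    using ramp_bounds[of s] assms by (intro integrable_const_bound[where B=1] AE_U01) auto
  show "(\<integral>x. ramp s x \<partial>U01) = 1 - s / 2"
  proof (cases "s = 0")
    case True
    have "(\<integral>x. ramp s x \<partial>U01) = (\<integral>x. 1 \<partial>U01)"
      by (intro integral_cong_AE AE_U01) (auto simp: True ramp_zero)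
    then show ?thesis using True by (simp add: prob_space)
  next
    case False
    \<comment> \<open>The factor \<open>ramp 0\<close>, almost everywhere 1, makes a first moment an
      instance of the product formula.\<close>
    have "(\<integral>x. ramp s x \<partial>U01) = (\<integral>x. ramp 0 x * ramp s x \<partial>U01)"
      by (intro integral_cong_AE AE_U01) (auto simp: ramp_zero)
    then show ?thesis using False assms by (simp add: expectation_ramp_mult(1))
  qed
qed

text \<open>Bookkeeping for the variance below, with \<open>x\<close>, \<open>y\<close>,
  \<open>k\<close> in place of r^2, s^2, r^2 / s so that only polynomial algebra remains; the factor
  3 clears denominators.\<close>

lemma proj_sum_sq_arith1: fixes r s x y k::real shows
   "3 * ((1 - 2 * r / 3) + (1 - 2 * s / 3) + 2 * (1 - s / 2 - k / 6)
        - 2 * (r + s) * (1 / 2 - x / 6) - 2 * (r + s) * (1 / 2 - y / 6)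
        + (r + s)\<^sup>2 * (1 / 3)) = 12 - 2 * r - 5 * s - k - (r + s) * (6 - x - y) + (r + s)\<^sup>2"
  by (simp add: algebra_simps)
text \<open>Here \<open>m\<close> is the mean of the ramp combination, so the cross term of the
  square is twice m^2.\<close>

lemma proj_sum_sq_arith2: fixes r s m::real assumes "m = 2 - r - s"
 shows "2 * m * (1 - r / 2) + 2 * m * (1 - s / 2) - 2 * m * (r + s) * (1 - 1 / 2) = 2 * m\<^sup>2"
  unfolding assms
  by (simp add: power2_eq_square algebra_simps)
lemma proj_sum_sq_arith3:
  "e = x - y + z \<Longrightarrow> 3 * x = w \<Longrightarrow> y = 2 * z \<Longrightarrow> 3 * e = w - 3 * z" for e :: real
  by simp

text \<open>With r = \<open>lo \<tau>\<close> and s = \<open>hi \<tau>\<close> the integrand is the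
  squared \<open>hajek\<close> variable. Expanding it leaves only products of two ramps, single
  ramps and a constant.\<close>

lemma expectation_proj_sum_sq:
  assumes "0 \<le> r" "r \<le> s" "0 < s" "s \<le> 1"
  shows "3 * (\<integral>u. (ramp r u + ramp s u - (r + s) * ramp 1 u - (2 - r - s))\<^sup>2 \<partial>U01)
    = 12 - 2 * r - 5 * s - r\<^sup>2 / s - (r + s) * (6 - r\<^sup>2 - s\<^sup>2) + (r + s)\<^sup>2 - 3 * (2 - r - s)\<^sup>2"
proof -
  interpret prob_space U01 by (rule prob_space_U01)
  let ?m = "2 - r - s"
  have r1: "r \<le> 1" using assms by simp
  have rr: "(\<integral>x. ramp r x * ramp r x \<partial>U01) = 1 - 2 * r / 3 \<and> integrable U01 (\<lambda>x. ramp r x * ramp r x)"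
  proof (cases "r = 0")
    case True
    have "(\<integral>x. ramp r x * ramp r x \<partial>U01) = (\<integral>x. ramp r x \<partial>U01)"
      by (intro integral_cong_AE AE_U01) (auto simp: True ramp_zero)
    moreover have "integrable U01 (\<lambda>x. ramp r x * ramp r x) \<longleftrightarrow> integrable U01 (ramp r)"
      by (intro integrable_cong_AE AE_U01) (auto simp: True ramp_zero)
    ultimately show ?thesis using expectation_ramp[of r] True by simp
  next
    case False
    then show ?thesis using expectation_ramp_mult[of r r] assms
      by (auto simp: field_simps power2_eq_square)
  qed
  have ss: "(\<integral>x. ramp s x * ramp s x \<partial>U01) = 1 - 2 * s / 3" "integrable U01 (\<lambda>x. ramp s x * ramp s x)"
    using expectation_ramp_mult[of s s] assms by (auto simp: field_simps power2_eq_square)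
  have oo: "(\<integral>x. ramp 1 x * ramp 1 x \<partial>U01) = 1 / 3" "integrable U01 (\<lambda>x. ramp 1 x * ramp 1 x)"
    using expectation_ramp_mult[of 1 1] by auto
  note rs = expectation_ramp_mult[OF assms]
  have ro: "(\<integral>x. ramp r x * ramp 1 x \<partial>U01) = 1 / 2 - r\<^sup>2 / 6" "integrable U01 (\<lambda>x. ramp r x * ramp 1 x)"
    using expectation_ramp_mult[of r 1] assms r1 by auto
  have so: "(\<integral>x. ramp s x * ramp 1 x \<partial>U01) = 1 / 2 - s\<^sup>2 / 6" "integrable U01 (\<lambda>x. ramp s x * ramp 1 x)"
    using expectation_ramp_mult[of s 1] assms by auto
  note e1 = expectation_ramp[OF assms(1) r1] and e2 = expectation_ramp[of s] and e3 = expectation_ramp[of 1]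
  have "(\<integral>u. (ramp r u + ramp s u - (r + s) * ramp 1 u - ?m)\<^sup>2 \<partial>U01)
    = (\<integral>u. (ramp r u * ramp r u + ramp s u * ramp s u + 2 * (ramp r u * ramp s u)
        - 2 * (r + s) * (ramp r u * ramp 1 u) - 2 * (r + s) * (ramp s u * ramp 1 u)
        + (r + s)\<^sup>2 * (ramp 1 u * ramp 1 u))
        - (2 * ?m * ramp r u + 2 * ?m * ramp s u - 2 * ?m * (r + s) * ramp 1 u) + ?m\<^sup>2 \<partial>U01)"
    by (rule Bochner_Integration.integral_cong[OF refl]) algebra
  also have "\<dots> = ((1 - 2 * r / 3) + (1 - 2 * s / 3) + 2 * (1 - s / 2 - (r\<^sup>2 / s) / 6)
        - 2 * (r + s) * (1 / 2 - r\<^sup>2 / 6) - 2 * (r + s) * (1 / 2 - s\<^sup>2 / 6)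
        + (r + s)\<^sup>2 * (1 / 3))
      - (2 * ?m * (1 - r / 2) + 2 * ?m * (1 - s / 2) - 2 * ?m * (r + s) * (1 - 1 / 2)) + ?m\<^sup>2"
  proof (rule has_bochner_integral_integral_eq, intro has_bochner_integral_add
      has_bochner_integral_diff has_bochner_integral_mult_right)
    show "has_bochner_integral U01 (\<lambda>u. ?m\<^sup>2) (?m\<^sup>2)"
      by (simp add: has_bochner_integral_iff prob_space)
  qed (use rr ss oo rs ro so e1 e2 e3 assms in \<open>auto simp: has_bochner_integral_iff\<close>)
  finally show ?thesis
    by (rule proj_sum_sq_arith3[OF _ proj_sum_sq_arith1 proj_sum_sq_arith2[OF refl]])
qed

section \<open>Closed forms of mean and variance\<close>

lemma mu_e_lo_hi:
  assumes "0 < \<tau>" shows "mu_e \<tau> = 1 - hi \<tau> / 2 - lo \<tau> / 2"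
proof (cases "\<tau> < 1")
  case True
  have "\<tau> * (\<tau> + 2) / (2 * (\<tau> + 1)) - (1 - 1 / (1 + \<tau>) / 2 - (1 - \<tau>) / 2) = 0"
    using assms
    by (simp add: add_divide_eq_iff divide_add_eq_iff diff_divide_eq_iff divide_diff_eq_iff) algebra
  then show ?thesis using True by (simp add: mu_e_def lo_def hi_def)
next
  case False
  then show ?thesis
    using assms by (simp add: mu_e_def lo_def hi_def divide_simps) (simp add: algebra_simps)
qed

text \<open>Used with q = 1 + \<tau>, h = 1 / q and A = 1 - \<tau>. The left side is a cubic in
  \<open>h\<close>; inserting powers of q h = 1 gives every term the factor h^3, after which a
  polynomial identity in \<open>q\<close> is left. \<open>?c0\<close>, \<open>?c1\<close>,
  \<open>?c2\<close> are the lower coefficients of the cubic.\<close>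

lemma nu_e_polynomial: fixes q h A::real assumes h: "q * h = 1" and A: "A = 2 - q"
  shows "12 - 2 * A - 5 * h - A\<^sup>2 * q - (A + h) * (6 - A\<^sup>2 - h\<^sup>2) + (A + h)\<^sup>2 - 3 * (q - h)\<^sup>2
   = (q - 1)\<^sup>2 * (4 * (q - 1) + 4 - 2 * (q - 1) ^ 4 - 4 * (q - 1) ^ 3 - (q - 1)\<^sup>2) * h^3"
proof -
  let ?c0 = "12 - 2 * A - A\<^sup>2 * q - A * (6 - A\<^sup>2) + A\<^sup>2 - 3 * q\<^sup>2"
  let ?c1 = "A\<^sup>2 + 2 * A + 6 * q - 11"
  let ?c2 = "A - 2"
  have "12 - 2 * A - 5 * h - A\<^sup>2 * q - (A + h) * (6 - A\<^sup>2 - h\<^sup>2) + (A + h)\<^sup>2 - 3 * (q - h)\<^sup>2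
    = ?c0 + ?c1 * h + ?c2 * h^2 + h^3"
    by (simp add: algebra_simps power2_eq_square power3_eq_cube)
  also have "\<dots> = ?c0 * (q * h)^3 + ?c1 * (q * h)^2 * h + ?c2 * (q * h) * h^2 + h^3"
    unfolding h by simp
  also have "\<dots> = (?c0 * q^3 + ?c1 * q^2 + ?c2 * q + 1) * h^3"
    by (simp add: algebra_simps power2_eq_square power3_eq_cube)
  also have "?c0 * q^3 + ?c1 * q^2 + ?c2 * q + 1 =
    (q - 1)\<^sup>2 * (4 * (q - 1) + 4 - 2 * (q - 1) ^ 4 - 4 * (q - 1) ^ 3 - (q - 1)\<^sup>2)"
    unfolding A
    by (simp add: algebra_simps power2_eq_square power3_eq_cube power4_eq_xxxx)
  finally show ?thesis .
qed

lemma nu_e_lo_hi: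
  assumes "0 < \<tau>" and "r = lo \<tau>" and "s = hi \<tau>"
  shows "12 - 2 * r - 5 * s - r\<^sup>2 / s - (r + s) * (6 - r\<^sup>2 - s\<^sup>2) + (r + s)\<^sup>2 - 3 * (2 - r - s)\<^sup>2
    = 3 * (4 * nu_e \<tau>)"
proof -
  define q where "q = 1 + \<tau>"
  have qs: "q * s = 1" using assms by (auto simp: hi_def q_def)
  then have div: "a / s = a * q" "a / (3 * q ^ 3) = a * s ^ 3 / 3" for a
    using assms by (simp_all add: hi_def q_def power_one_over)
  show ?thesis
  proof (cases "\<tau> < 1")
    case True
    have r: "r = 2 - q" "2 - r - s = q - s" using assms True by (auto simp: lo_def q_def)
    have "4 * nu_e \<tau> = (q - 1)\<^sup>2 * (4 * (q - 1) + 4 - 2 * (q - 1) ^ 4 - 4 * (q - 1) ^ 3 - (q - 1)\<^sup>2)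
        / (3 * q ^ 3)"
      using True by (simp add: nu_e_def q_def add.commute)
    then show ?thesis unfolding div r(2) nu_e_polynomial[OF qs r(1)] by simp
  next
    case False
    have r: "r = 0" using assms False by (auto simp: lo_def)
    have "4 * nu_e \<tau> = (q - 1)\<^sup>2 / (3 * q ^ 3)"
      using False by (simp add: nu_e_def q_def add.commute)
    then have "3 * (4 * nu_e \<tau>) = (q - 1)\<^sup>2 * s ^ 3" unfolding div by simp
    also have "\<dots> = (q * s)\<^sup>2 * s - 2 * (q * s) * s\<^sup>2 + s ^ 3"
      by (simp add: algebra_simps power2_eq_square power3_eq_cube)
    also have "\<dots> = s - 2 * s\<^sup>2 + s ^ 3" unfolding qs by simp
    also have "\<dots> = 12 - 2 * r - 5 * s - r\<^sup>2 / s - (r + s) * (6 - r\<^sup>2 - s\<^sup>2) + (r + s)\<^sup>2 - 3 * (2 - r - s)\<^sup>2"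
      unfolding r by (simp add: algebra_simps power2_eq_square power3_eq_cube)
    finally show ?thesis by simp
  qed
qed

text \<open>The limit theorem requires a nondegenerate projection. Below 1 all powers of \<tau> are
  at most \<tau>, so the bracket is at least 4 - 3 \<tau>.\<close>

lemma nu_e_pos: assumes "0 < \<tau>" shows "0 < 4 * nu_e \<tau>"
proof (cases "\<tau> < 1")
  case True
  have "\<tau> ^ 4 \<le> \<tau>" "\<tau> ^ 3 \<le> \<tau>" "\<tau>\<^sup>2 \<le> \<tau>"
    using True assms power_decreasing[of 1 _ \<tau>] by auto
  then have "0 < 4 * \<tau> + 4 - 2 * \<tau> ^ 4 - 4 * \<tau> ^ 3 - \<tau>\<^sup>2" using True by linarith
  then show ?thesis using True assms by (simp add: nu_e_def)
qed (use assms in \<open>simp add: nu_e_def\<close>)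

text \<open>The region is the interval from u (1 - \<tau>) to u (1 + \<tau>), clipped to the unit
  interval: clipping at 0 produces \<open>lo\<close>, clipping at 1 the ramp.\<close>

lemma measure_out_region:
  assumes "0 < \<tau>" "u \<in> {0<..<1}"
  shows "measure U01 {v. \<bar>v - u\<bar> < \<tau> * u} = ramp (hi \<tau>) u - lo \<tau> * ramp 1 u"
proof -
  have "{0<..<1} \<inter> {v. \<bar>v - u\<bar> < \<tau> * u} = {max 0 (u * (1 - \<tau>)) <..< min 1 (u * (1 + \<tau>))}"
    by (auto simp: algebra_simps)
  moreover have "max 0 (u * (1 - \<tau>)) = lo \<tau> * u"
    using assms by (auto simp: lo_def max_def mult_le_0_iff zero_le_mult_iff)
  moreover have "min 1 (u * (1 + \<tau>)) = ramp (hi \<tau>) u"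
    using assms by (auto simp: ramp_def hi_def field_simps)
  moreover have "lo \<tau> * u \<le> ramp (hi \<tau>) u"
  proof -
    have "u * (1 - \<tau>) \<le> u * 1" "u * (1 - \<tau>) \<le> u * (1 + \<tau>)"
      using assms by (intro mult_left_mono; simp)+
    moreover have "0 \<le> u * (1 + \<tau>)" "u \<le> 1" using assms by simp_all
    ultimately have "max 0 (u * (1 - \<tau>)) \<le> min 1 (u * (1 + \<tau>))"
      by linarith
    then show ?thesis
      using \<open>max 0 _ = _\<close> \<open>min 1 _ = _\<close> by simp
  qed
  ultimately show ?thesis
    using assms by (simp add: ramp_one)
qed

text \<open>Solving for the tail \<open>u\<close> instead of the head exchanges the roles of
  \<open>lo\<close> and \<open>hi\<close>: \<open>u\<close> lies above v / (1 + \<tau>) and, if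
  \<tau> < 1, below v / (1 - \<tau>).\<close>

lemma measure_in_region:
  assumes "0 < \<tau>" "v \<in> {0<..<1}"
  shows "measure U01 {u. \<bar>v - u\<bar> < \<tau> * u} = ramp (lo \<tau>) v - hi \<tau> * ramp 1 v"
proof -
  have "{0<..<1} \<inter> {u. \<bar>v - u\<bar> < \<tau> * u} = {hi \<tau> * v <..< ramp (lo \<tau>) v}"
  proof (intro set_eqI)
    fix u
    have "hi \<tau> * v < u \<longleftrightarrow> v - u < \<tau> * u" using assms by (auto simp: hi_def field_simps)
    \<comment> \<open>For \<tau> at least 1 the constraint u - v < \<tau> u always holds, and
      \<open>ramp 0\<close> supplies the endpoint 1.\<close>
    moreover have "u < ramp (lo \<tau>) v \<longleftrightarrow> u < 1 \<and> u - v < \<tau> * u" if "0 < u"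
    proof (cases "\<tau> < 1")
      case True
      have *: "u - v < \<tau> * u \<longleftrightarrow> u < v / (1 - \<tau>)" using True by (simp add: field_simps)
      have **: "v / (1 - \<tau>) < 1 \<longleftrightarrow> v < 1 - \<tau>" using True by (simp add: field_simps)
      have "ramp (lo \<tau>) v = (if v < 1 - \<tau> then v / (1 - \<tau>) else 1)"
        using True by (simp add: ramp_def lo_def)
      then show ?thesis unfolding * ** [symmetric] by auto
    next
      case False
      then have "1 * u \<le> \<tau> * u" using that by (intro mult_right_mono) auto
      then have "u - v < \<tau> * u" using assms by auto
      then show ?thesis using False assms by (auto simp: ramp_def lo_def)
    qed
    moreover have "0 < hi \<tau> * v" using lo_hi[OF assms(1)] assms by simp
    ultimately show "u \<in> {0<..<1} \<inter> {u. \<bar>v - u\<bar> < \<tau> * u} \<longleftrightarrow> u \<in> {hi \<tau> * v <..< ramp (lo \<tau>) v}"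
      by (cases "0 < u") (auto simp: abs_less_iff)
  qed
  moreover have "hi \<tau> * v \<le> ramp (lo \<tau>) v"
  proof -
    have "hi \<tau> * v \<le> v" using lo_hi[OF assms(1)] assms mult_right_mono[of "hi \<tau>" 1 v] by simp
    moreover have "v \<le> ramp (lo \<tau>) v"
      using lo_hi[OF assms(1)] assms by (auto simp: ramp_def divide_simps mult_left_le)
    ultimately show ?thesis by simp
  qed
  ultimately show ?thesis
    using assms by (simp add: ramp_one)
qed

section \<open>The end intervals\<close>

text \<open>\<open>e\<close> is the point of \<open>Y\<close> that bounds the interval and
  \<open>w\<close> the signed length, negative on the left.\<close>

locale end_interval =
  fixes e w \<tau> :: real
  assumes w: "w \<noteq> 0" and tau: "0 < \<tau>"
begin

definition I :: "real set" where "I = (\<lambda>u. e + w * u) ` {0<..<1}"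

text \<open>The absolute value of x - e covers both ends with one formula; clipping to the interval
  is left to \<open>h\<close>.\<close>

definition near :: "real \<Rightarrow> real \<Rightarrow> bool" where "near x y \<longleftrightarrow> \<bar>y - x\<bar> < \<tau> * \<bar>x - e\<bar>"

definition V :: "real measure" where "V = uniform_measure lborel I"

definition h :: "real \<Rightarrow> real \<Rightarrow> real" where "h x y = of_bool (x \<in> I \<and> y \<in> I \<and> near x y)"

lemma I_measurable [measurable]: "I \<in> sets borel"
  unfolding I_def by (rule affine_image_borel[OF w])

lemma V_distr: "V = distr U01 borel (\<lambda>u. e + w * u)"
  unfolding V_def I_def by (rule uniform_measure_affine[OF w])

lemma sets_V [measurable_cong, simp]: "sets V = sets borel"
  by (simp add: V_def)

lemma space_V [simp]: "space V = UNIV"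
  by (simp add: V_def)

lemma prob_space_V: "prob_space V"
  unfolding V_distr by (rule prob_space.prob_space_distr[OF prob_space_U01]) simp

lemma integral_V: "f \<in> borel_measurable borel \<Longrightarrow> integral\<^sup>L V f = (\<integral>u. f (e + w * u) \<partial>U01)"
  for f :: "real \<Rightarrow> real"
  unfolding V_distr by (rule integral_distr) simp_all

lemma near_measurable [measurable (raw)]:
  assumes [measurable]: "f \<in> borel_measurable M" "g \<in> borel_measurable M"
  shows "Measurable.pred M (\<lambda>x. near (f x) (g x))"
  unfolding near_def by measurable

lemma near_affine: "near (e + w * u) (e + w * v) \<longleftrightarrow> \<bar>v - u\<bar> < \<tau> * \<bar>u\<bar>"
proof -
  have "\<bar>(e + w * v) - (e + w * u)\<bar> = \<bar>w\<bar> * \<bar>v - u\<bar>"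
    by (simp add: abs_mult[symmetric] right_diff_distrib)
  moreover have "\<tau> * \<bar>(e + w * u) - e\<bar> = \<bar>w\<bar> * (\<tau> * \<bar>u\<bar>)" by (simp add: abs_mult)
  ultimately have "near (e + w * u) (e + w * v) \<longleftrightarrow> \<bar>w\<bar> * \<bar>v - u\<bar> < \<bar>w\<bar> * (\<tau> * \<bar>u\<bar>)"
    unfolding near_def by (simp only:)
  also have "\<dots> \<longleftrightarrow> \<bar>v - u\<bar> < \<tau> * \<bar>u\<bar>"
    using w by (intro mult_less_cancel_left_pos) simp
  finally show ?thesis .
qed

lemma affine_in_I: "e + w * u \<in> I \<longleftrightarrow> 0 < u \<and> u < 1"
  unfolding I_def using w by auto

sublocale bounded_kernel V h 1
proof (intro bounded_kernel.intro bounded_kernel_axioms.intro prob_space_V)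
  show "case_prod h \<in> borel_measurable (V \<Otimes>\<^sub>M V)"
    unfolding h_def case_prod_beta by measurable
qed (simp add: h_def)

lemma proj1_affine: "0 < u \<Longrightarrow> u < 1 \<Longrightarrow> proj1 (e + w * u) = ramp (hi \<tau>) u - lo \<tau> * ramp 1 u"
proof -
  assume u: "0 < u" "u < 1"
  have "proj1 (e + w * u) = (\<integral>v. h (e + w * u) (e + w * v) \<partial>U01)"
    unfolding proj1_def by (rule integral_V) measurable
  also have "\<dots> = (\<integral>v. indicator {v. \<bar>v - u\<bar> < \<tau> * u} v \<partial>U01)"
    using u by (intro integral_cong_AE AE_U01) (auto simp: h_def near_affine affine_in_I)
  also have "\<dots> = ramp (hi \<tau>) u - lo \<tau> * ramp 1 u"
    using measure_out_region[OF tau, of u] u by simp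
  finally show ?thesis .
qed

lemma proj2_affine: "0 < v \<Longrightarrow> v < 1 \<Longrightarrow> proj2 (e + w * v) = ramp (lo \<tau>) v - hi \<tau> * ramp 1 v"
proof -
  assume v: "0 < v" "v < 1"
  have "proj2 (e + w * v) = (\<integral>u. h (e + w * u) (e + w * v) \<partial>U01)"
    unfolding proj2_def by (rule integral_V) measurable
  also have "\<dots> = (\<integral>u. indicator {u. \<bar>v - u\<bar> < \<tau> * u} u \<partial>U01)"
    using v by (intro integral_cong_AE AE_U01) (auto simp: h_def near_affine affine_in_I)
  also have "\<dots> = ramp (lo \<tau>) v - hi \<tau> * ramp 1 v"
    using measure_in_region[OF tau, of v] v by simp
  finally show ?thesis .
qed

lemma mean_eq: "mean = mu_e \<tau>"
proof -
  have "mean = (\<integral>u. proj1 (e + w * u) \<partial>U01)"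
    unfolding mean_def by (rule integral_V) (use proj1_measurable in simp)
  also have "\<dots> = (\<integral>u. ramp (hi \<tau>) u - lo \<tau> * ramp 1 u \<partial>U01)"
    by (intro integral_cong_AE AE_U01) (use proj1_measurable in \<open>auto simp: proj1_affine\<close>)
  also have "\<dots> = mu_e \<tau>"
    using expectation_ramp[of "hi \<tau>"] expectation_ramp[of 1] lo_hi[OF tau]
    by (simp add: mu_e_lo_hi[OF tau])
  finally show ?thesis .
qed

lemma hajek_variance: "expectation (\<lambda>x. (hajek x)\<^sup>2) = 4 * nu_e \<tau>"
proof -
  let ?r = "lo \<tau>" and ?s = "hi \<tau>"
  have [measurable]: "hajek \<in> borel_measurable borel" using hajek_measurable by simp
  have "expectation (\<lambda>x. (hajek x)\<^sup>2) = (\<integral>u. (hajek (e + w * u))\<^sup>2 \<partial>U01)"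
    by (rule integral_V) simp
  also have "\<dots> = (\<integral>u. (ramp ?r u + ramp ?s u - (?r + ?s) * ramp 1 u - (2 - ?r - ?s))\<^sup>2 \<partial>U01)"
  proof (intro integral_cong_AE AE_U01)
    fix u :: real assume u: "0 < u" "u < 1"
    have "hajek (e + w * u) = ramp ?r u + ramp ?s u - (?r + ?s) * ramp 1 u - (2 - ?r - ?s)"
      unfolding hajek_def proj1_affine[OF u] proj2_affine[OF u] mean_eq mu_e_lo_hi[OF tau]
      by (simp add: algebra_simps)
    then show "(hajek (e + w * u))\<^sup>2
        = (ramp ?r u + ramp ?s u - (?r + ?s) * ramp 1 u - (2 - ?r - ?s))\<^sup>2" by simp
  qed simp_all
  finally have "3 * expectation (\<lambda>x. (hajek x)\<^sup>2) = 3 * (4 * nu_e \<tau>)"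
    unfolding nu_e_lo_hi[OF tau refl refl, symmetric]
    using expectation_proj_sum_sq[of ?r ?s] lo_hi[OF tau] by simp
  then show ?thesis by simp
qed

lemma clt_end_interval:
  "weak_conv_m (\<lambda>k. distr (PiM {..<k} (\<lambda>_. V)) borel (\<lambda>x. sqrt (real k) * (ustat k x - mu_e \<tau>)))
    (normal_dist 0 (4 * nu_e \<tau>))"
  using clt_ustat[of "sqrt (4 * nu_e \<tau>)"] nu_e_pos[OF tau] by (simp add: hajek_variance mean_eq)

end

text \<open>The enumeration of the points is left open because two are needed: first occurrences,
  valid on every outcome, for measurability, and the renumbered hits for the law.\<close>

lemma relative_density_cs_digraph:
  assumes I: "y_interval \<delta>1 \<delta>2 Y i = I"
    and N: "\<And>x y. x \<in> I \<Longrightarrow> y \<in> N_end \<delta>1 \<delta>2 Y \<tau> x \<longleftrightarrow> y \<in> I \<and> R x y"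
    and F: "S \<inter> I = f ` F" "inj_on f F" "F \<subseteq> {..<n}"
  shows "relative_density (cs_digraph \<delta>1 \<delta>2 Y S i \<tau> c)
    = (\<Sum>(a, b)\<in>offdiag n. of_bool (a \<in> F \<and> b \<in> F \<and> R (f a) (f b))) / (real (card F) * (real (card F) - 1))"
proof -
  have sub: "f ` F \<subseteq> I" using F(1) by auto
  have "{(u, v). u \<in> f ` F \<and> v \<in> f ` F \<and> u \<noteq> v \<and> v \<in> N_end \<delta>1 \<delta>2 Y \<tau> u}
      = {(u, v). u \<in> f ` F \<and> v \<in> f ` F \<and> u \<noteq> v \<and> R u v}"
    using N sub by blast
  then show ?thesis
    unfolding relative_density_def cs_digraph_def Let_def I F(1)
    using card_arcs_image[OF F(2,3)] by (simp add: card_image[OF F(2)])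
qed

text \<open>The common form of both ends. Positive length outside the interval is what gives exactly
  \<open>k\<close> hits a positive probability when \<open>N k\<close> exceeds
  \<open>k\<close>.\<close>

lemma (in prob_space) clt_relative_density:
  fixes X :: "nat \<Rightarrow> 'a \<Rightarrow> real"
  assumes \<tau>: "0 < \<tau>" and w: "w \<noteq> 0"
    and ind: "indep_vars (\<lambda>_. borel) X UNIV"
    and unif: "\<And>j. distr M borel (X j) = uniform_measure lborel {\<delta>1<..<\<delta>2}"
    and I: "y_interval \<delta>1 \<delta>2 Y i = (\<lambda>u. e + w * u) ` {0<..<1}"
    and I_sub: "y_interval \<delta>1 \<delta>2 Y i \<subseteq> {\<delta>1<..<\<delta>2}"
    and I_less: "emeasure lborel ({\<delta>1<..<\<delta>2} - y_interval \<delta>1 \<delta>2 Y i) \<noteq> 0"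
    and NE: "\<And>x y. x \<in> y_interval \<delta>1 \<delta>2 Y i \<Longrightarrow>
      y \<in> N_end \<delta>1 \<delta>2 Y \<tau> x \<longleftrightarrow> y \<in> y_interval \<delta>1 \<delta>2 Y i \<and> \<bar>y - x\<bar> < \<tau> * \<bar>x - e\<bar>"
    and N: "\<And>k. k \<le> N k"
  shows "weak_conv_m
    (\<lambda>k. distr
       (uniform_measure M {\<omega> \<in> space M. card (sample X (N k) \<omega> \<inter> y_interval \<delta>1 \<delta>2 Y i) = k})
       borel
       (\<lambda>\<omega>. sqrt (real k) *
          (relative_density (cs_digraph \<delta>1 \<delta>2 Y (sample X (N k) \<omega>) i \<tau> c) - mu_e \<tau>)))
    (normal_dist 0 (4 * nu_e \<tau>))"
proof -
  interpret EI: end_interval e w \<tau> using w \<tau> by unfold_locales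
  let ?S = "{\<delta>1<..<\<delta>2}" and ?D = "uniform_measure lborel {\<delta>1<..<\<delta>2}"
  have yI: "y_interval \<delta>1 \<delta>2 Y i = EI.I" using I by (simp add: EI.I_def)
  note IS = I_sub[unfolded yI] and IL = I_less[unfolded yI] and NE' = NE[unfolded yI, folded EI.near_def]
  have lI: "emeasure lborel EI.I \<noteq> 0"
  proof
    assume "emeasure lborel EI.I = 0"
    \<comment> \<open>A null \<open>I\<close> would give total mass 0 / 0, which is 0 in
      \<open>ennreal\<close>.\<close>
    then have "emeasure EI.V UNIV = 0" unfolding EI.V_def by simp
    moreover have "emeasure EI.V UNIV = 1"
      using prob_space.emeasure_space_1[OF EI.prob_space_V] by simp
    ultimately show False by simp
  qed
  have fin: "emeasure lborel EI.I \<noteq> top" "emeasure lborel ?S \<noteq> top" "emeasure lborel ?S \<noteq> 0"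
  proof -
    have "emeasure lborel ?S < \<infinity>" by (rule emeasure_bounded_finite) simp
    then show S: "emeasure lborel ?S \<noteq> top" by simp
    show "emeasure lborel EI.I \<noteq> top"
      using emeasure_mono[OF IS, of lborel] S by (auto simp: top_unique)
    show "emeasure lborel ?S \<noteq> 0"
      using emeasure_mono[OF IS, of lborel] lI by auto
  qed
  interpret CS: conditioned_sample M X borel ?D EI.V EI.I
  proof
    show "indep_vars (\<lambda>_. borel) X UNIV" by (rule ind)
    fix A :: "real set" assume A: "A \<in> sets borel"
    have "?S \<inter> (A \<inter> EI.I) = EI.I \<inter> A" "?S \<inter> EI.I = EI.I" using IS by auto
    then have "emeasure ?D (A \<inter> EI.I) = emeasure lborel (EI.I \<inter> A) / emeasure lborel ?S"
      and "emeasure ?D EI.I = emeasure lborel EI.I / emeasure lborel ?S"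
      and "emeasure EI.V A = emeasure lborel (EI.I \<inter> A) / emeasure lborel EI.I"
      using A EI.I_measurable by (simp_all add: EI.V_def)
    moreover have "i / s * (t / i) = (i * (t / i)) / s" for i s t :: ennreal
      by (simp add: divide_ennreal_def mult_ac)
    ultimately show "emeasure ?D (A \<inter> EI.I) = emeasure ?D EI.I * emeasure EI.V A"
      using lI fin(1) by (simp add: ennreal_times_divide_cancel)
  qed (simp_all add: unif)
  have inj: "AE \<omega> in M. inj (\<lambda>j. X j \<omega>)"
  proof (rule AE_inj_on_sample[OF ind])
    show "emeasure (distr M borel (X j)) {x} = 0" for j x
      by (cases "x \<in> ?S") (simp_all add: unif)
  qed
  have X [measurable]: "X j \<in> borel_measurable M" for j by (rule CS.X_measurable)
  {
    fix k
    let ?n = "N k"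
    let ?F = "\<lambda>\<omega>. first_hits (\<lambda>j. X j \<omega>) EI.I ?n"
    let ?T = "\<lambda>\<omega>. sqrt (real k) *
          (relative_density (cs_digraph \<delta>1 \<delta>2 Y (sample X ?n \<omega>) i \<tau> c) - mu_e \<tau>)"
    let ?E = "{\<omega> \<in> space M. card (sample X ?n \<omega> \<inter> EI.I) = k}"
    have F: "sample X ?n \<omega> \<inter> EI.I = (\<lambda>j. X j \<omega>) ` ?F \<omega>" for \<omega>
      unfolding sample_def by (rule first_hits_image[symmetric])
    have card_F: "real (card (?F \<omega>)) = (\<Sum>j<?n. of_bool (j \<in> ?F \<omega>))" for \<omega>
      using first_hits_subset[of "\<lambda>j. X j \<omega>" EI.I ?n] by (simp add: Int_absorb1 Int_def[symmetric] Int_commute)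
    have [measurable]: "Measurable.pred M (\<lambda>\<omega>. j \<in> ?F \<omega>)" for j
      by (rule first_hits_measurable) simp_all
    have [measurable]: "(\<lambda>\<omega>. real (card (?F \<omega>))) \<in> borel_measurable M"
      unfolding card_F by measurable
    have "?E = {\<omega> \<in> space M. real (card (?F \<omega>)) = real k}"
      unfolding F card_image[OF first_hits_inj] by simp
    also have "\<dots> \<in> events" by measurable
    finally have E: "?E \<in> events" .
    \<comment> \<open>Through first occurrences the statistic is a finite sum of measurable
      indicators divided by a measurable count.\<close>
    have T: "?T \<in> borel_measurable M"
      unfolding relative_density_cs_digraph[OF yI NE' F first_hits_inj first_hits_subset, simplified] case_prod_beta
      by measurable
    have E_AE: "AE \<omega> in M. \<omega> \<in> ?E \<longleftrightarrow> card (hits X EI.I ?n \<omega>) = k"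
      using inj AE_space
    proof eventually_elim
      case (elim \<omega>)
      have "sample X ?n \<omega> \<inter> EI.I = (\<lambda>j. X j \<omega>) ` hits X EI.I ?n \<omega>"
        by (auto simp: sample_def hits_def)
      with elim show ?case by (simp add: card_image inj_on_subset)
    qed
    have pos: "emeasure M ?E \<noteq> 0"
    proof -
      have "emeasure M ?E = emeasure M {\<omega> \<in> space M. card (hits X EI.I ?n \<omega>) = k}"
        using E E_AE CS.hits_card_law(3)[OF sets.top] by (intro emeasure_eq_AE) auto
      moreover have "emeasure ?D EI.I \<noteq> 0" "emeasure ?D (space borel - EI.I) \<noteq> 0"
      proof -
        have "?S \<inter> (UNIV - EI.I) = ?S - EI.I" by blast
        then show "emeasure ?D EI.I \<noteq> 0" "emeasure ?D (space borel - EI.I) \<noteq> 0"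
          using IS IL lI fin EI.I_measurable by (auto simp: Int_absorb1 ennreal_divide_eq_0_iff)
      qed
      ultimately show ?thesis using CS.emeasure_hits_pos[OF N] by simp
    qed
    have T_AE: "AE \<omega> in M. card (hits X EI.I ?n \<omega>) = k \<longrightarrow>
        ?T \<omega> = sqrt (real k) * (EI.ustat k (hit_values X (hits X EI.I ?n \<omega>) \<omega>) - mu_e \<tau>)"
      using inj
    proof eventually_elim
      case (elim \<omega>)
      let ?J = "hits X EI.I ?n \<omega>"
      let ?z = "hit_values X ?J \<omega>"
      show ?case
      proof
        assume k: "card ?J = k"
        note bij = bij_betw_nth_sorted[OF finite_hits, of X EI.I ?n \<omega>, unfolded k]
        have z: "?z a = X (sorted_list_of_set ?J ! a) \<omega>" if "a < k" for a
          using that by (simp add: hit_values_def k)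
        have inj_z: "inj_on ?z {..<k}"
          using bij elim z by (auto simp: inj_on_def bij_betw_def inj_def)
        have "?z ` {..<k} = (\<lambda>j. X j \<omega>) ` ((\<lambda>a. sorted_list_of_set ?J ! a) ` {..<k})"
          using z by (auto simp: image_image)
        also have "\<dots> = (\<lambda>j. X j \<omega>) ` ?J" unfolding bij_betw_imp_surj_on[OF bij] ..
        also have "\<dots> = sample X ?n \<omega> \<inter> EI.I" by (auto simp: sample_def hits_def)
        finally have im: "sample X ?n \<omega> \<inter> EI.I = ?z ` {..<k}" ..
        have "relative_density (cs_digraph \<delta>1 \<delta>2 Y (sample X ?n \<omega>) i \<tau> c)
            = (\<Sum>(a, b)\<in>offdiag k. of_bool (a \<in> {..<k} \<and> b \<in> {..<k} \<and> EI.near (?z a) (?z b)))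
              / (real k * (real k - 1))"
          using relative_density_cs_digraph[OF yI NE' im inj_z order_refl] by simp
        also have "(\<Sum>(a, b)\<in>offdiag k. of_bool (a \<in> {..<k} \<and> b \<in> {..<k} \<and> EI.near (?z a) (?z b)))
            = (\<Sum>(a, b)\<in>offdiag k. EI.h (?z a) (?z b))"
        proof (rule sum.cong[OF refl], clarify)
          fix a b assume "(a, b) \<in> offdiag k"
          then have ab: "a < k" "b < k" by (auto simp: offdiag_def)
          then have "?z a \<in> EI.I" "?z b \<in> EI.I" using im by blast+
          with ab show "of_bool (a \<in> {..<k} \<and> b \<in> {..<k} \<and> EI.near (?z a) (?z b)) = EI.h (?z a) (?z b)"
            by (simp add: EI.h_def)
        qed
        finally show "?T \<omega> = sqrt (real k) * (EI.ustat k ?z - mu_e \<tau>)"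
          by (simp add: EI.ustat_def)
      qed
    qed
    \<comment> \<open>Equality of laws for each \<open>k\<close>; the sample size \<open>N k\<close>
      no longer appears on the right.\<close>
    have "distr (uniform_measure M ?E) borel ?T
        = distr (PiM {..<k} (\<lambda>_. EI.V)) borel (\<lambda>x. sqrt (real k) * (EI.ustat k x - mu_e \<tau>))"
      by (rule CS.distr_given_card[OF E E_AE pos T _ T_AE]) measurable
  }
  then show ?thesis unfolding yI using EI.clt_end_interval by simp
qed

theorem theorem4p9:
  fixes \<delta>1 \<delta>2 \<tau> c :: real and Y :: "real set" and m i :: nat
    and M :: "'a measure" and X :: "nat \<Rightarrow> 'a \<Rightarrow> real" and N :: "nat \<Rightarrow> nat"
  assumes "\<delta>1 < \<delta>2"
    and "finite Y" and "card Y = m" and "m \<ge> 1" and "Y \<subseteq> {\<delta>1<..<\<delta>2}"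
    and "0 < c" and "c < 1"
    and "0 < \<tau>"
    and "i \<in> {1, m + 1}"
    and "prob_space M"
    and "prob_space.indep_vars M (\<lambda>_. borel) X UNIV"
    and "\<And>j. distr M borel (X j) = uniform_measure lborel {\<delta>1<..<\<delta>2}"
    \<comment> \<open>\<open>N k\<close> is an arbitrary total sample size compatible with \<open>n\<^sub>i = k\<close>; the limit
       \<open>n\<^sub>i \<rightarrow> \<infinity>\<close> is along the conditional laws given \<open>n\<^sub>i = k\<close> as \<open>k \<rightarrow> \<infinity>\<close>\<close>
    and "\<And>k. k \<le> N k"
  shows "weak_conv_m
    (\<lambda>k. distr
       (uniform_measure M
          {\<omega> \<in> space M. card (sample X (N k) \<omega> \<inter> y_interval \<delta>1 \<delta>2 Y i) = k})
       borel
       (\<lambda>\<omega>. sqrt (real k) *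
          (relative_density (cs_digraph \<delta>1 \<delta>2 Y (sample X (N k) \<omega>) i \<tau> c) - mu_e \<tau>)))
    (normal_dist 0 (4 * nu_e \<tau>))"
proof -
  let ?a = "ypt \<delta>1 \<delta>2 Y 1" and ?b = "ypt \<delta>1 \<delta>2 Y m"
  let ?L = "sorted_list_of_set Y"
  have len: "length ?L = m" using assms by simp
  have a: "?a = ?L ! 0" and b: "?b = ?L ! (m - 1)" using assms by (auto simp: ypt_def)
  have "?L ! 0 \<in> set ?L" "?L ! (m - 1) \<in> set ?L" using len assms(4) by (auto intro!: nth_mem)
  then have aY: "\<delta>1 < ?a" "?a < \<delta>2" and bY: "\<delta>1 < ?b" "?b < \<delta>2"
    unfolding a b using assms(2,5) by auto
  \<comment> \<open>This keeps the two end intervals disjoint, so that on the right one the first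
    branch of \<open>N_end\<close> is not taken.\<close>
  have ab: "?a \<le> ?b"
    unfolding a b using len assms(4) by (intro sorted_nth_mono) auto
  have I1: "y_interval \<delta>1 \<delta>2 Y 1 = {\<delta>1<..<?a}" by (simp add: y_interval_def ypt_def)
  have I2: "y_interval \<delta>1 \<delta>2 Y (m + 1) = {?b<..<\<delta>2}"
    using assms(3) by (simp add: y_interval_def ypt_def)
  note clt = prob_space.clt_relative_density[OF assms(10) assms(8) _ assms(11,12) _ _ _ _ assms(13)]
  have affine_image: "{min e (e + w)<..<max e (e + w)} = (\<lambda>u. e + w * u) ` {0<..<1}" if "w \<noteq> 0" for e w :: real
  proof -
    have "x \<in> {min e (e + w)<..<max e (e + w)} \<longleftrightarrow> (x - e) / w \<in> {0<..<1}" for x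
      using that by (cases "0 < w") (auto simp: field_simps)
    moreover have "x = e + w * ((x - e) / w)" for x using that by simp
    moreover have "(e + w * u - e) / w = u" for u using that by simp
    ultimately show ?thesis by (auto simp only: set_eq_iff image_iff)
  qed
  show ?thesis
  proof (cases "i = 1")
    case True
    have i: "y_interval \<delta>1 \<delta>2 Y i = {\<delta>1<..<?a}" using True I1 by simp
    show ?thesis
    \<comment> \<open>The negative scale reverses orientation, sending 0 to the point of
      \<open>Y\<close> and 1 to \<open>\<delta>1\<close>.\<close>
    proof (rule clt[where w="\<delta>1 - ?a" and e="?a"])
      show "\<delta>1 - ?a \<noteq> 0" using aY by simp
      then show "y_interval \<delta>1 \<delta>2 Y i = (\<lambda>u. ?a + (\<delta>1 - ?a) * u) ` {0<..<1}"
        using affine_image[of "\<delta>1 - ?a" ?a] aY by (simp add: i)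
      show "y_interval \<delta>1 \<delta>2 Y i \<subseteq> {\<delta>1<..<\<delta>2}" using aY by (auto simp: i)
      have "{?a<..<\<delta>2} \<subseteq> {\<delta>1<..<\<delta>2} - y_interval \<delta>1 \<delta>2 Y i" using aY by (auto simp: i)
      from emeasure_mono[OF this, of lborel] show "emeasure lborel ({\<delta>1<..<\<delta>2} - y_interval \<delta>1 \<delta>2 Y i) \<noteq> 0"
        using aY by (auto simp: i)
      show "y \<in> N_end \<delta>1 \<delta>2 Y \<tau> x \<longleftrightarrow> y \<in> y_interval \<delta>1 \<delta>2 Y i \<and> \<bar>y - x\<bar> < \<tau> * \<bar>x - ?a\<bar>"
        if "x \<in> y_interval \<delta>1 \<delta>2 Y i" for x y
        using that unfolding i N_end_def Let_def I1 by (auto simp: abs_less_iff)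
    qed
  next
    case False
    then have i: "y_interval \<delta>1 \<delta>2 Y i = {?b<..<\<delta>2}" using I2 assms(9) by simp
    show ?thesis
    proof (rule clt[where w="\<delta>2 - ?b" and e="?b"])
      show "\<delta>2 - ?b \<noteq> 0" using bY by simp
      then show "y_interval \<delta>1 \<delta>2 Y i = (\<lambda>u. ?b + (\<delta>2 - ?b) * u) ` {0<..<1}"
        using affine_image[of "\<delta>2 - ?b" ?b] bY by (simp add: i)
      show "y_interval \<delta>1 \<delta>2 Y i \<subseteq> {\<delta>1<..<\<delta>2}" using bY by (auto simp: i)
      have "{\<delta>1<..<?b} \<subseteq> {\<delta>1<..<\<delta>2} - y_interval \<delta>1 \<delta>2 Y i" using bY by (auto simp: i)
      from emeasure_mono[OF this, of lborel] show "emeasure lborel ({\<delta>1<..<\<delta>2} - y_interval \<delta>1 \<delta>2 Y i) \<noteq> 0"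
        using bY by (auto simp: i)
      show "y \<in> N_end \<delta>1 \<delta>2 Y \<tau> x \<longleftrightarrow> y \<in> y_interval \<delta>1 \<delta>2 Y i \<and> \<bar>y - x\<bar> < \<tau> * \<bar>x - ?b\<bar>"
        if "x \<in> y_interval \<delta>1 \<delta>2 Y i" for x y
        using that ab unfolding i N_end_def Let_def I1 I2 assms(3) by (auto simp: abs_less_iff)
    qed
  qed
qed

end
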